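(* Let $(\mathfrak g,J_M)$ be an $8$-dimensional real nilpotent Lie algebra with a 1-abelian complex structure defined by a regular (invertible) non-Hermitian matrix $M\in M_3(\mathbb C)$. Then the Lie algebra $\mathfrak g$ is isomorphic to one in the following list, where in all cases $\{e^1,\dots,e^8\}$ is a basis of $1$-forms in which $e^j$, $j=1,\dots,6$, are closed: (i) $\mathfrak g^8_{r1}$: $de^7=e^{13}+e^{24}+e^{56}$, $de^8=e^{36}-e^{45}$; (ii) $\mathfrak g^8_{r2}$: $de^7=e^{13}+e^{24}+e^{56}$, $de^8=e^{34}$; (iii) $\mathfrak g^8_{r3}$: $de^7=e^{13}+e^{24}$, $de^8=e^{34}+e^{56}$; (iv) $\mathfrak g^8_{r4}$: $de^7=e^{12}$, $de^8=e^{34}+e^{56}$; (v) $\mathfrak g^8_{r5}$: $de^7=e^{13}+e^{24}+e^{56}$, $de^8=e^{14}-e^{23}$; (vi) $\mathfrak g^8_{r6}$: $de^7=e^{12}+e^{34}$, $de^8=e^{34}+e^{56}$.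
   Context: $e^{jk}=e^j\wedge e^k$, and $d$ is the Chevalley–Eilenberg differential (so the structure equations determine the Lie algebra). For a complex structure $J$ on a real Lie algebra $\mathfrak g$, $\mathfrak g^{1,0}\subset\mathfrak g^*_{\mathbb C}$ is the space of $(1,0)$-forms. $J$ is abelian if $[Jx,Jy]=[x,y]$ for all $x,y$. An abelian complex structure on a $2n$-dimensional nilpotent Lie algebra is 1-abelian if $h^{1,0}=\dim H^{1,0}_{\bar\partial}(\mathfrak g)=\dim\ker(\bar\partial:\mathfrak g^{1,0}\to\bigwedge^{1,1}\mathfrak g^* )$ equals $n-1$. For every 1-abelian complex structure there are a basis $\{\omega^i\}_{i=1}^n$ of $\mathfrak g^{1,0}$ and a nonzero $M\in M_{n-1}(\mathbb C)$ with $d\omega^1=\dots=d\omega^{n-1}=0$ and $d\omega^n=\sum_{j,k=1}^{n-1}M_{jk}\,\omega^{j}\wedge\overline{\omega^{k}}$; the structure is then denoted $J_M$. A matrix $M$ is Hermitian if $M=\bar M^T$.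
   Formalization: "Non-Hermitian" is taken to mean that the structure J_M is not defined by any Hermitian matrix, i.e. no nonzero complex multiple of M is Hermitian; for M = iI, non-Hermitian in the literal sense, the derived algebra is 1-dimensional and the claim fails. *)

theory Defs
  imports "HOL-Analysis.Analysis" "HOL-Library.Function_Algebras"
begin

section \<open>Real Lie algebras\<close>

locale real_lie_algebra =
  fixes br :: "'a::real_vector \<Rightarrow> 'a \<Rightarrow> 'a"
  assumes bilinear: "bilinear br"
    and alternating: "br x x = 0"
    and jacobi: "br x (br y z) + br y (br z x) + br z (br x y) = 0"

primrec lower_central_series :: "('a::real_vector \<Rightarrow> 'a \<Rightarrow> 'a) \<Rightarrow> nat \<Rightarrow> 'a set" where
  "lower_central_series br 0 = UNIV"
| "lower_central_series br (Suc k) = span {br x y | x y. y \<in> lower_central_series br k}"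

definition nilpotent_lie :: "('a::real_vector \<Rightarrow> 'a \<Rightarrow> 'a) \<Rightarrow> bool" where
  "nilpotent_lie br \<longleftrightarrow> (\<exists>k. lower_central_series br k = {0})"

definition lie_isomorphic ::
    "('a::real_vector \<Rightarrow> 'a \<Rightarrow> 'a) \<Rightarrow> ('b::real_vector \<Rightarrow> 'b \<Rightarrow> 'b) \<Rightarrow> bool" where
  "lie_isomorphic br br' \<longleftrightarrow>
     (\<exists>f. linear f \<and> bij f \<and> (\<forall>x y. f (br x y) = br' (f x) (f y)))"


section \<open>Forms and the Chevalley--Eilenberg differential\<close>

text \<open>Real and complex forms are functions with values in \<open>real\<close> resp. \<open>complex\<close>; elements of
  the complexified dual are the real-linear maps to \<open>complex\<close>. Conventions:
  \<open>(\<alpha> \<and> \<beta>)(x, y) = \<alpha>(x) \<beta>(y) - \<alpha>(y) \<beta>(x)\<close> and \<open>(d\<alpha>)(x, y) = - \<alpha>([x, y])\<close>.\<close>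

definition wedge :: "('a \<Rightarrow> 'c::comm_ring) \<Rightarrow> ('a \<Rightarrow> 'c) \<Rightarrow> 'a \<Rightarrow> 'a \<Rightarrow> 'c" where
  "wedge \<alpha> \<beta> x y = \<alpha> x * \<beta> y - \<alpha> y * \<beta> x"

definition ce_d :: "('a \<Rightarrow> 'a \<Rightarrow> 'a) \<Rightarrow> ('a \<Rightarrow> 'c::ab_group_add) \<Rightarrow> 'a \<Rightarrow> 'a \<Rightarrow> 'c" where
  "ce_d br \<alpha> x y = - \<alpha> (br x y)"

text \<open>The complex vector space of all complex-valued functions, in which the spaces of complex
  1-forms live.\<close>

global_interpretation cform: vector_space "\<lambda>(c::complex) (f :: 'a \<Rightarrow> complex) x. c * f x"
  defines cform_span = cform.span
    and cform_dependent = cform.dependent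
    and cform_dim = cform.dim
  by unfold_locales (auto simp: fun_eq_iff algebra_simps)


section \<open>Abelian complex structures\<close>

definition complex_structure :: "('a::real_vector \<Rightarrow> 'a \<Rightarrow> 'a) \<Rightarrow> ('a \<Rightarrow> 'a) \<Rightarrow> bool" where
  "complex_structure br J \<longleftrightarrow> linear J \<and> (\<forall>x. J (J x) = - x) \<and>
     (\<forall>x y. br (J x) (J y) - J (br (J x) y) - J (br x (J y)) - br x y = 0)"

definition abelian_complex_structure ::
    "('a::real_vector \<Rightarrow> 'a \<Rightarrow> 'a) \<Rightarrow> ('a \<Rightarrow> 'a) \<Rightarrow> bool" where
  "abelian_complex_structure br J \<longleftrightarrow>
     complex_structure br J \<and> (\<forall>x y. br (J x) (J y) = br x y)"

definition forms_1_0 :: "('a::real_vector \<Rightarrow> 'a) \<Rightarrow> ('a \<Rightarrow> complex) set" where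
  "forms_1_0 J = {\<omega>. linear \<omega> \<and> (\<forall>x. \<omega> (J x) = \<i> * \<omega> x)}"

text \<open>A complex 2-form \<open>\<Omega>\<close> satisfies \<open>\<Omega>(Jx, Jy) = \<Omega>(x, y)\<close> if it has type \<open>(1,1)\<close> and
  \<open>\<Omega>(Jx, Jy) = - \<Omega>(x, y)\<close> if it is a sum of forms of type \<open>(2,0)\<close> and \<open>(0,2)\<close>, so the
  following is the projection onto the \<open>(1,1)\<close>-component.\<close>

definition proj_1_1 :: "('a \<Rightarrow> 'a) \<Rightarrow> ('a \<Rightarrow> 'a \<Rightarrow> complex) \<Rightarrow> 'a \<Rightarrow> 'a \<Rightarrow> complex" where
  "proj_1_1 J \<Omega> x y = (\<Omega> x y + \<Omega> (J x) (J y)) / 2"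

definition dbar ::
    "('a \<Rightarrow> 'a \<Rightarrow> 'a) \<Rightarrow> ('a \<Rightarrow> 'a) \<Rightarrow> ('a \<Rightarrow> complex) \<Rightarrow> 'a \<Rightarrow> 'a \<Rightarrow> complex" where
  "dbar br J \<omega> = proj_1_1 J (ce_d br \<omega>)"

definition h_1_0 :: "('a::real_vector \<Rightarrow> 'a \<Rightarrow> 'a) \<Rightarrow> ('a \<Rightarrow> 'a) \<Rightarrow> nat" where
  "h_1_0 br J = cform_dim {\<omega> \<in> forms_1_0 J. \<forall>x y. dbar br J \<omega> x y = 0}"

definition one_abelian ::
    "nat \<Rightarrow> ('a::real_vector \<Rightarrow> 'a \<Rightarrow> 'a) \<Rightarrow> ('a \<Rightarrow> 'a) \<Rightarrow> bool" where
  "one_abelian n br J \<longleftrightarrow>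
     real_lie_algebra br \<and> nilpotent_lie br \<and>
     n \<ge> 1 \<and> dim (UNIV :: 'a set) = 2 * n \<and>
     abelian_complex_structure br J \<and> h_1_0 br J = n - 1"


section \<open>The structures \<open>J\<^sub>M\<close>\<close>

definition basis_1_0 ::
    "('a::real_vector \<Rightarrow> 'a) \<Rightarrow> ('m \<Rightarrow> 'a \<Rightarrow> complex) \<Rightarrow> ('a \<Rightarrow> complex) \<Rightarrow> bool" where
  "basis_1_0 J \<eta> \<zeta> \<longleftrightarrow> inj \<eta> \<and> \<zeta> \<notin> range \<eta> \<and>
     \<not> cform_dependent (insert \<zeta> (range \<eta>)) \<and>
     cform_span (insert \<zeta> (range \<eta>)) = forms_1_0 J"

text \<open>The type \<open>'m\<close> indexes \<open>\<omega>\<^sup>1, \<dots>, \<omega>\<^sup>n\<^sup>-\<^sup>1\<close> (the family \<open>\<eta>\<close>), and \<open>\<zeta>\<close> is \<open>\<omega>\<^sup>n\<close>.\<close>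

definition is_J_M ::
    "('a::real_vector \<Rightarrow> 'a \<Rightarrow> 'a) \<Rightarrow> ('a \<Rightarrow> 'a) \<Rightarrow> complex^'m^'m \<Rightarrow> bool" where
  "is_J_M br J M \<longleftrightarrow> M \<noteq> 0 \<and>
     (\<exists>(\<eta> :: 'm \<Rightarrow> 'a \<Rightarrow> complex) \<zeta>. basis_1_0 J \<eta> \<zeta> \<and>
        (\<forall>j x y. ce_d br (\<eta> j) x y = 0) \<and>
        (\<forall>x y. ce_d br \<zeta> x y =
           (\<Sum>j\<in>UNIV. \<Sum>k\<in>UNIV. M $ j $ k * wedge (\<eta> j) (\<lambda>v. cnj (\<eta> k v)) x y)))"

definition hermitian_matrix :: "complex^'m^'m \<Rightarrow> bool" where
  "hermitian_matrix M \<longleftrightarrow> M = map_matrix cnj (transpose M)"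

text \<open>The matrix \<open>M\<close> is not determined by the structure: replacing \<open>\<omega>\<^sup>n\<close> by \<open>c \<omega>\<^sup>n\<close> replaces \<open>M\<close>
  by \<open>c M\<close>. Hence \<open>J\<^sub>M\<close> counts as non-Hermitian only if no admissible basis has a Hermitian
  matrix, i.e. if no nonzero multiple of \<open>M\<close> is Hermitian. For instance \<open>M = \<i> I\<close> defines the
  same structures as the Hermitian matrix \<open>M = I\<close>.\<close>

lemma is_J_M_scale:
  fixes M :: "complex^'m^'m"
  assumes "is_J_M br J M" and c: "c \<noteq> 0"
  shows "is_J_M br J (map_matrix ((*) c) M)"
proof -
  obtain \<eta> :: "'m \<Rightarrow> 'a \<Rightarrow> complex" and \<zeta> where M: "M \<noteq> 0" and b: "basis_1_0 J \<eta> \<zeta>"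
    and d\<eta>: "\<forall>j x y. ce_d br (\<eta> j) x y = 0"
    and d\<zeta>: "\<forall>x y. ce_d br \<zeta> x y =
      (\<Sum>j\<in>UNIV. \<Sum>k\<in>UNIV. M $ j $ k * wedge (\<eta> j) (\<lambda>v. cnj (\<eta> k v)) x y)"
    using assms(1) unfolding is_J_M_def by blast
  define \<zeta>' where "\<zeta>' = (\<lambda>x. c * \<zeta> x)"
  have \<zeta>: "\<zeta> = (\<lambda>x. inverse c * \<zeta>' x)"
    using c by (simp add: \<zeta>'_def fun_eq_iff)
  let ?B = "range \<eta>"
  have mem: "\<zeta> \<in> cform.span S" if "\<zeta>' \<in> cform.span S" for S
    using cform.span_scale[OF that, of "inverse c"] \<zeta> by simp
  have mem': "\<zeta>' \<in> cform.span S" if "\<zeta> \<in> cform.span S" for S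
    using cform.span_scale[OF that, of c] by (simp add: \<zeta>'_def)
  have ind: "\<zeta> \<notin> cform.span ?B" "\<not> cform.dependent ?B"
    using b cform.independent_insert[of \<zeta> ?B] unfolding basis_1_0_def by auto
  have "\<zeta>' \<notin> cform.span ?B"
    using ind mem by blast
  moreover from this have "\<zeta>' \<notin> ?B"
    using cform.span_base by blast
  moreover have "\<not> cform.dependent (insert \<zeta>' ?B)"
    using calculation ind cform.independent_insert[of \<zeta>' ?B] by simp
  moreover have "cform.span (insert \<zeta>' ?B) = cform.span (insert \<zeta> ?B)"
    unfolding cform.span_eq
    using mem[of "insert \<zeta>' ?B"] mem'[of "insert \<zeta> ?B"]
    by (auto intro: cform.span_base)
  ultimately have "basis_1_0 J \<eta> \<zeta>'"
    using b unfolding basis_1_0_def by simp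
  moreover have "ce_d br \<zeta>' x y =
      (\<Sum>j\<in>UNIV. \<Sum>k\<in>UNIV. map_matrix ((*) c) M $ j $ k * wedge (\<eta> j) (\<lambda>v. cnj (\<eta> k v)) x y)"
    for x y
  proof -
    have "ce_d br \<zeta>' x y = c * ce_d br \<zeta> x y"
      by (simp add: ce_d_def \<zeta>'_def)
    then show ?thesis
      by (simp add: d\<zeta> sum_distrib_left mult.assoc)
  qed
  moreover have "map_matrix ((*) c) M \<noteq> 0"
    using M c by (simp add: vec_eq_iff)
  ultimately show ?thesis
    using d\<eta> unfolding is_J_M_def by blast
qed


section \<open>The Lie algebras of the list\<close>

text \<open>All of them live on \<open>real^8\<close>, with \<open>e k\<close> the coordinate form. The indices are numerals of the
  type \<open>8\<close>, where \<open>1, \<dots>, 8\<close> are pairwise distinct (and \<open>8 = 0\<close>).\<close>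

definition e :: "8 \<Rightarrow> real^8 \<Rightarrow> real" where
  "e k v = v $ k"

definition ee :: "8 \<Rightarrow> 8 \<Rightarrow> real^8 \<Rightarrow> real^8 \<Rightarrow> real" where
  "ee j k = wedge (e j) (e k)"

text \<open>The bracket determined by \<open>de\<^sup>1 = \<dots> = de\<^sup>6 = 0\<close>, \<open>de\<^sup>7 = \<Omega>\<close>, \<open>de\<^sup>8 = \<Psi>\<close>;
  see \<open>ce_d_bracket_of\<close> and \<open>bracket_of_unique\<close> below.\<close>

definition bracket_of ::
    "(real^8 \<Rightarrow> real^8 \<Rightarrow> real) \<Rightarrow> (real^8 \<Rightarrow> real^8 \<Rightarrow> real) \<Rightarrow> real^8 \<Rightarrow> real^8 \<Rightarrow> real^8" where
  "bracket_of \<Omega> \<Psi> x y = (\<chi> k. if k = 7 then - \<Omega> x y else if k = 8 then - \<Psi> x y else 0)"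

definition g8_r1 where "g8_r1 = bracket_of (ee 1 3 + ee 2 4 + ee 5 6) (ee 3 6 - ee 4 5)"
definition g8_r2 where "g8_r2 = bracket_of (ee 1 3 + ee 2 4 + ee 5 6) (ee 3 4)"
definition g8_r3 where "g8_r3 = bracket_of (ee 1 3 + ee 2 4) (ee 3 4 + ee 5 6)"
definition g8_r4 where "g8_r4 = bracket_of (ee 1 2) (ee 3 4 + ee 5 6)"
definition g8_r5 where "g8_r5 = bracket_of (ee 1 3 + ee 2 4 + ee 5 6) (ee 1 4 - ee 2 3)"
definition g8_r6 where "g8_r6 = bracket_of (ee 1 2 + ee 3 4) (ee 3 4 + ee 5 6)"

lemma eight_exhaust: "k \<in> {1, 2, 3, 4, 5, 6, 7, 8}" for k :: 8
proof (cases k)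
  case (of_int z)
  then have "z \<in> {0, 1, 2, 3, 4, 5, 6, 7}" by auto
  with of_int show ?thesis by auto
qed

lemma ce_d_bracket_of:
  "ce_d (bracket_of \<Omega> \<Psi>) (e 7) = \<Omega>"
  "ce_d (bracket_of \<Omega> \<Psi>) (e 8) = \<Psi>"
  "k \<in> {1, 2, 3, 4, 5, 6} \<Longrightarrow> ce_d (bracket_of \<Omega> \<Psi>) (e k) = 0"
  by (auto simp: fun_eq_iff ce_d_def e_def bracket_of_def)

lemma bracket_of_unique:
  assumes "ce_d br (e 7) = \<Omega>" "ce_d br (e 8) = \<Psi>"
    and "\<And>k. k \<in> {1, 2, 3, 4, 5, 6} \<Longrightarrow> ce_d br (e k) = 0"
  shows "br = bracket_of \<Omega> \<Psi>"
proof (intro ext, unfold vec_eq_iff, rule allI)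
  fix x y k
  have "ce_d br (e k) x y = ce_d (bracket_of \<Omega> \<Psi>) (e k) x y"
    using eight_exhaust[of k] assms ce_d_bracket_of[where \<Omega> = \<Omega> and \<Psi> = \<Psi>] by fastforce
  then show "br x y $ k = bracket_of \<Omega> \<Psi> x y $ k"
    by (simp add: ce_d_def e_def)
qed

lemma real_lie_algebra_list:
  "real_lie_algebra g8_r1" "real_lie_algebra g8_r2" "real_lie_algebra g8_r3"
  "real_lie_algebra g8_r4" "real_lie_algebra g8_r5" "real_lie_algebra g8_r6"
  by (unfold_locales;
      auto simp: bilinear_def g8_r1_def g8_r2_def g8_r3_def g8_r4_def g8_r5_def g8_r6_def
        bracket_of_def ee_def wedge_def e_def vec_eq_iff algebra_simps intro!: linearI)+

end

theory Submission
  imports Defs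
begin

text \<open>Write \<open>d\<omega>\<^sup>4 = \<Sum> M\<^sub>j\<^sub>k \<omega>\<^sup>j \<and> cnj \<omega>\<^sup>k\<close>. Its real and imaginary parts are two real two-forms on
  \<open>\<complex>\<^sup>3 = \<real>\<^sup>6\<close>, and the real Lie algebra depends only on the pencil that they span, up to changes of
  basis of \<open>\<real>\<^sup>6\<close> and of the pencil. The complex structure can therefore be forgotten, and with it all
  the signs that occur in the classification of matrices up to \<open>*\<close>-congruence.

  Decomposing \<open>M\<close> into its Hermitian and skew-Hermitian parts, the pencil consists of the imaginary
  parts of the sesquilinear forms of a pencil of Hermitian matrices. As \<open>M\<close> is invertible, so is some
  real member \<open>A\<close> of it (\<open>hermitian_pencil_3\<close>). Let \<open>F\<close> be the symplectic form of \<open>A\<close>, let \<open>B\<close> be a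
  second generator and let \<open>N\<close> be the operator with \<open>F (N x) y\<close> equal to the form of \<open>B\<close>. Then \<open>N\<close> is
  self-adjoint for \<open>F\<close> and \<open>F (N x) x = 0\<close>, so that every cyclic subspace of \<open>N\<close> is isotropic. A
  pencil with such an \<open>F\<close> is determined by the Jordan type of \<open>N\<close>, in which all blocks occur twice:
  each block on vectors \<open>x, N x, \<dots>\<close> pairs with a second one on \<open>y, N y, \<dots>\<close>, found from a vector \<open>y\<close>
  dual to the last nonzero \<open>N\<^sup>k x\<close>.

  By Cayley--Hamilton \<open>N\<close> satisfies a cubic equation, with real coefficients since \<open>A\<close> and \<open>B\<close> are
  Hermitian (\<open>real_cubic_of_hermitian_pencil\<close>). A real cubic has a real root, which leaves six types.
  If \<open>N\<close> is diagonalizable over the reals, it has three or two distinct eigenvalues and the pencil is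
  that of \<open>r6\<close> or \<open>r4\<close> (\<open>diagonalizable\<close>); one eigenvalue would make \<open>N\<close> a scalar and a multiple of \<open>M\<close>
  Hermitian. A Jordan block of size two with a different third eigenvalue gives \<open>r3\<close>
  (\<open>double_and_simple_root\<close>), with the same third eigenvalue \<open>r2\<close> (\<open>square_zero\<close>), a block of size three
  gives \<open>r1\<close> (\<open>cube_zero\<close>), and a pair of nonreal eigenvalues gives \<open>r5\<close> (\<open>complex_roots\<close>).\<close>

section \<open>Pairs of real two-forms\<close>

text \<open>A complex-valued two-form \<open>D\<close> is a pair of real ones; the real-linearly independent numbers \<open>k\<close>
  and \<open>l\<close> express a change of basis of their pencil. The pair \<open>\<Omega>\<close>, \<open>\<Psi>\<close> lives on the coordinates
  \<open>1, \<dots>, 6\<close>, hence the condition that \<open>T\<close> ignores the other two.\<close>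
definition realizes ::
    "('v::real_vector \<Rightarrow> 'v \<Rightarrow> complex) \<Rightarrow> (real^8 \<Rightarrow> real^8 \<Rightarrow> real) \<Rightarrow> (real^8 \<Rightarrow> real^8 \<Rightarrow> real) \<Rightarrow> bool"
  where
  "realizes D \<Omega> \<Psi> \<longleftrightarrow> (\<exists>T k l. linear T \<and> (\<forall>x. (\<forall>i. i \<notin> {7, 8} \<longrightarrow> x $ i = 0) \<longrightarrow> T x = 0) \<and>
     Im (k * cnj l) \<noteq> 0 \<and>
     (\<forall>x y. D (T x) (T y) = of_real (\<Omega> x y) * k + of_real (\<Psi> x y) * l))"

text \<open>The structure equations of \<open>r1\<close>, \<dots>, \<open>r6\<close>, in this order.\<close>
definition in_list :: "('v::real_vector \<Rightarrow> 'v \<Rightarrow> complex) \<Rightarrow> bool" where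
  "in_list D \<longleftrightarrow>
     realizes D (ee 1 3 + ee 2 4 + ee 5 6) (ee 3 6 - ee 4 5) \<or>
     realizes D (ee 1 3 + ee 2 4 + ee 5 6) (ee 3 4) \<or>
     realizes D (ee 1 3 + ee 2 4) (ee 3 4 + ee 5 6) \<or>
     realizes D (ee 1 2) (ee 3 4 + ee 5 6) \<or>
     realizes D (ee 1 3 + ee 2 4 + ee 5 6) (ee 1 4 - ee 2 3) \<or>
     realizes D (ee 1 2 + ee 3 4) (ee 3 4 + ee 5 6)"

text \<open>The linear map that sends the first six unit vectors to \<open>v1, \<dots>, v6\<close> pulls \<open>D\<close> back to the form with
  their Gram matrix, so only fifteen values have to be compared.\<close>
lemma realizes_by_six_vectors:
  fixes D :: "'v::real_vector \<Rightarrow> 'v \<Rightarrow> complex"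
  assumes "bilinear D" and alt: "\<And>x. D x x = 0" and kl: "Im (k * cnj l) \<noteq> 0"
    and gram: "\<And>x y. of_real (\<Omega> x y) * k + of_real (\<Psi> x y) * l =
      ee 1 2 x y * D v1 v2 + ee 1 3 x y * D v1 v3 + ee 1 4 x y * D v1 v4 + ee 1 5 x y * D v1 v5 +
      ee 1 6 x y * D v1 v6 + ee 2 3 x y * D v2 v3 + ee 2 4 x y * D v2 v4 + ee 2 5 x y * D v2 v5 +
      ee 2 6 x y * D v2 v6 + ee 3 4 x y * D v3 v4 + ee 3 5 x y * D v3 v5 + ee 3 6 x y * D v3 v6 +
      ee 4 5 x y * D v4 v5 + ee 4 6 x y * D v4 v6 + ee 5 6 x y * D v5 v6"
  shows "realizes D \<Omega> \<Psi>"
proof -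
  define T :: "real^8 \<Rightarrow> 'v" where "T x = x$1 *\<^sub>R v1 + x$2 *\<^sub>R v2 + x$3 *\<^sub>R v3 +
    x$4 *\<^sub>R v4 + x$5 *\<^sub>R v5 + x$6 *\<^sub>R v6" for x
  note b = bilinear_ladd[OF assms(1)] bilinear_radd[OF assms(1)]
    bilinear_lmul[OF assms(1)] bilinear_rmul[OF assms(1)]
  have swap: "D y x = - D x y" for x y
  proof -
    have "D (x + y) (x + y) = D y x + D x y" by (simp only: b) (simp add: alt)
    then have "D y x + D x y = 0" by (metis alt)
    then show ?thesis by (simp only: eq_neg_iff_add_eq_0)
  qed
  have "D (T x) (T y) = of_real (\<Omega> x y) * k + of_real (\<Psi> x y) * l" for x y
    unfolding gram T_def
    by (simp add: b alt swap[of v1] swap[of v2 v3] swap[of v2 v4] swap[of v2 v5] swap[of v2 v6]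
        swap[of v3 v4] swap[of v3 v5] swap[of v3 v6] swap[of v4 v5] swap[of v4 v6] swap[of v5 v6]
        ee_def wedge_def e_def scaleR_conv_of_real) (simp add: algebra_simps)
  moreover have "linear T"
    by (intro linearI) (simp_all add: T_def algebra_simps)
  moreover have "T x = 0" if "\<forall>i. i \<notin> {7, 8} \<longrightarrow> x $ i = 0" for x
    using that by (simp add: T_def)
  ultimately show ?thesis
    unfolding realizes_def using kl by blast
qed

section \<open>Pencils with a symplectic member\<close>

text \<open>The pencil is spanned by \<open>F\<close> and \<open>F (N x) y\<close>. The last assumption is the only trace of the dimension:
  it produces vectors in the complement of up to two planes that are already in normal form.\<close>
locale symplectic_pencil =
  fixes F :: "'v::real_vector \<Rightarrow> 'v \<Rightarrow> real" and N :: "'v \<Rightarrow> 'v"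
  assumes F_bilinear: "bilinear F"
    and F_alt [simp]: "F x x = 0"
    and F_nondegenerate: "(\<And>y. F x y = 0) \<Longrightarrow> x = 0"
    and N_linear: "linear N"
    and FN_alt [simp]: "F (N x) x = 0"
    and orthogonal_to_four: "\<exists>w. w \<noteq> 0 \<and> F w a = 0 \<and> F w b = 0 \<and> F w c = 0 \<and> F w d = 0"
begin

lemmas F_simps [simp] =
  bilinear_ladd[OF F_bilinear] bilinear_radd[OF F_bilinear]
  bilinear_lsub[OF F_bilinear] bilinear_rsub[OF F_bilinear]
  bilinear_lmul[OF F_bilinear] bilinear_rmul[OF F_bilinear]
  bilinear_lneg[OF F_bilinear] bilinear_rneg[OF F_bilinear]
  bilinear_lzero[OF F_bilinear] bilinear_rzero[OF F_bilinear]

lemmas N_simps [simp] =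
  linear_add[OF N_linear] linear_diff[OF N_linear] linear_cmul[OF N_linear]
  linear_neg[OF N_linear] linear_0[OF N_linear]

lemma F_swap: "F y x = - F x y"
  using F_alt[of "x + y"] by (simp del: F_alt) (simp add: F_alt)

lemma selfadjoint [simp]: "F x (N y) = F (N x) y"
  using FN_alt[of "x + y"] F_swap[of "N y" x] by (simp del: FN_alt) (simp add: FN_alt)

lemma FN2_alt [simp]: "F (N (N x)) x = 0"
  using selfadjoint[of "N x" x] by (metis F_alt)

lemma FN3_alt [simp]: "F (N (N (N x))) x = 0"
  using FN_alt[of "N x"] by simp

lemma dual_vector:
  assumes "x \<noteq> 0" obtains y where "F x y = 1"
proof -
  obtain z where "F x z \<noteq> 0" using F_nondegenerate assms by blast
  then have "F x ((1 / F x z) *\<^sub>R z) = 1" by simp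
  then show ?thesis using that by blast
qed

text \<open>Replacing the second generator of the pencil by its sum with a multiple of \<open>F\<close> moves any eigenvalue to \<open>0\<close>.\<close>
lemma shift: "symplectic_pencil F (\<lambda>x. N x - r *\<^sub>R x)"
  by unfold_locales
    (use F_bilinear F_nondegenerate orthogonal_to_four in
      \<open>auto intro!: linearI simp: algebra_simps\<close>)

definition D :: "complex \<Rightarrow> complex \<Rightarrow> 'v \<Rightarrow> 'v \<Rightarrow> complex" where
  "D p q x y = of_real (F x y) * p + of_real (F (N x) y) * q"

lemma D_shift:
  "D p q = symplectic_pencil.D F (\<lambda>x. N x - r *\<^sub>R x) (p + of_real r * q) q"
  by (simp add: fun_eq_iff D_def symplectic_pencil.D_def[OF shift]) (simp add: algebra_simps)

lemma D_realizes:
  assumes "Im (k * cnj l) \<noteq> 0"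
    and "\<And>x y. of_real (\<Omega> x y) * k + of_real (\<Psi> x y) * l =
      ee 1 2 x y * D p q v1 v2 + ee 1 3 x y * D p q v1 v3 + ee 1 4 x y * D p q v1 v4 +
      ee 1 5 x y * D p q v1 v5 + ee 1 6 x y * D p q v1 v6 + ee 2 3 x y * D p q v2 v3 +
      ee 2 4 x y * D p q v2 v4 + ee 2 5 x y * D p q v2 v5 + ee 2 6 x y * D p q v2 v6 +
      ee 3 4 x y * D p q v3 v4 + ee 3 5 x y * D p q v3 v5 + ee 3 6 x y * D p q v3 v6 +
      ee 4 5 x y * D p q v4 v5 + ee 4 6 x y * D p q v4 v6 + ee 5 6 x y * D p q v5 v6"
  shows "realizes (D p q) \<Omega> \<Psi>"
proof (rule realizes_by_six_vectors[OF _ _ assms(1)])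
  show "bilinear (D p q)"
    unfolding bilinear_def
    by (auto intro!: linearI simp: D_def scaleR_conv_of_real algebra_simps)
qed (use assms in \<open>simp_all add: D_def\<close>)

section \<open>Normal forms\<close>

text \<open>A vector \<open>y\<close> dual to \<open>N\<^sup>2 x\<close> makes \<open>x, N x, N\<^sup>2 x, y, N y, N\<^sup>2 y\<close> a basis in which
  \<open>F (N\<^sup>i x) (N\<^sup>j y)\<close> depends only on \<open>i + j\<close> and all other values vanish.\<close>
lemma cube_zero:
  assumes pq: "Im (p * cnj q) \<noteq> 0" and cube: "\<And>x. N (N (N x)) = 0" and "N (N x) \<noteq> 0"
  shows "realizes (D p q) (ee 1 3 + ee 2 4 + ee 5 6) (ee 3 6 - ee 4 5)"
proof -
  obtain z where z: "F (N (N x)) z = 1" using dual_vector assms(3) by blast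
  \<comment> \<open>adding multiples of \<open>N z\<close> and \<open>N (N z)\<close> corrects the pairing with \<open>N x\<close> first, then that with \<open>x\<close>\<close>
  define s where "s = - F (N x) z"
  define t where "t = - F x z - s * F (N x) z"
  define y where "y = z + s *\<^sub>R N z + t *\<^sub>R N (N z)"
  have f: "F (N (N x)) y = 1" "F (N x) y = 0" "F x y = 0"
    using z by (simp_all add: y_def s_def t_def cube)
  have g: "F (N (N y)) x = - 1" "F (N y) x = 0" "F y x = 0"
    using f F_swap[of x y] F_swap[of "N x" y] F_swap[of "N (N x)" y] by simp_all
  show ?thesis
    by (rule D_realizes[OF pq, where ?v1.0 = "- N (N y)" and ?v2.0 = "N (N x)" and ?v3.0 = x
          and ?v4.0 = y and ?v5.0 = "N x" and ?v6.0 = "N y"])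
      (simp add: D_def f g cube algebra_simps)
qed

text \<open>Besides the block on \<open>x, N x\<close> and its dual on \<open>y, N y\<close> there is one hyperbolic pair in the kernel of \<open>N\<close>.\<close>
lemma square_zero:
  assumes pq: "Im (p * cnj q) \<noteq> 0" and square: "\<And>x. N (N x) = 0" and "N x \<noteq> 0"
  shows "realizes (D p q) (ee 1 3 + ee 2 4 + ee 5 6) (ee 3 4)"
proof -
  obtain z where z: "F (N x) z = 1" using dual_vector assms(3) by blast
  define y where "y = z - F x z *\<^sub>R N z"
  have f: "F (N x) y = 1" "F x y = 0"
    using z by (simp_all add: y_def square)
  have g: "F (N y) x = - 1" "F y x = 0"
    using f F_swap[of x y] F_swap[of "N x" y] by simp_all
  obtain w where w: "w \<noteq> 0" "F w x = 0" "F w (N x) = 0" "F w y = 0" "F w (N y) = 0"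
    using orthogonal_to_four by blast
  \<comment> \<open>\<open>N w\<close> is again orthogonal to the four vectors, and \<open>N\<close> kills it\<close>
  define u where "u = (if N w = 0 then w else N w)"
  have u: "u \<noteq> 0" "N u = 0" "F u x = 0" "F u y = 0"
    using w by (simp_all add: u_def square)
  obtain v0 where v0: "F u v0 = 1" using dual_vector u(1) by blast
  \<comment> \<open>the component of \<open>v0\<close> orthogonal to \<open>x, N x, y, N y\<close>\<close>
  define v where "v = v0 - F x v0 *\<^sub>R N y - F (N x) v0 *\<^sub>R y + F (N y) v0 *\<^sub>R x + F y v0 *\<^sub>R N x"
  have v: "F u v = 1" "F x v = 0" "F (N x) v = 0" "F y v = 0" "F (N y) v = 0"
    using v0 u f g by (simp_all add: v_def square)
  have u': "F x u = 0" "F y u = 0" "F (N x) u = 0" "F (N y) u = 0"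
    using u F_swap[of x u] F_swap[of y u] F_swap[of "N x" u] F_swap[of "N y" u] by simp_all
  show ?thesis
    by (rule D_realizes[OF pq, where ?v1.0 = "- N y" and ?v2.0 = "N x" and ?v3.0 = x
          and ?v4.0 = y and ?v5.0 = u and ?v6.0 = v])
      (simp add: D_def f g u u' v square algebra_simps)
qed

text \<open>The space splits into the generalized eigenspaces for \<open>0\<close> and \<open>b\<close>, which are orthogonal for both
  forms. In \<open>r3\<close> the second form, not the first, involves \<open>e\<^sup>5\<^sup>6\<close>; the member of the pencil that
  vanishes on the eigenspace for \<open>b\<close> takes the place of \<open>F\<close>, which explains the value \<open>1 / b\<close> of \<open>F x y\<close>
  below.\<close>
lemma double_and_simple_root:
  assumes pq: "Im (p * cnj q) \<noteq> 0" and b: "b \<noteq> 0"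
    and cubic: "\<And>x. N (N (N x)) = b *\<^sub>R N (N x)"
    and "N (N x1) \<noteq> b *\<^sub>R N x1" and "N (N x2) \<noteq> 0"
  shows "realizes (D p q) (ee 1 3 + ee 2 4) (ee 3 4 + ee 5 6)"
proof -
  define x where "x = N x1 - b *\<^sub>R x1"
  have x: "N x \<noteq> 0" "N (N x) = 0" using assms(4) by (simp_all add: x_def cubic)
  obtain z0 where z0: "F (N x) z0 = 1" using dual_vector x by blast
  \<comment> \<open>the projection of \<open>z0\<close> onto the kernel of \<open>N\<^sup>2\<close>\<close>
  define z where "z = z0 - (1 / b^2) *\<^sub>R N (N z0)"
  have z: "F (N x) z = 1" "N (N z) = 0"
    using z0 x b by (simp_all add: z_def cubic power2_eq_square)
  define y where "y = z + (1 / b - F x z) *\<^sub>R N z"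
  have f: "F (N x) y = 1" "F x y = 1 / b" "N (N y) = 0"
    using z x by (simp_all add: y_def)
  have g: "F (N y) x = - 1" "F y x = - 1 / b"
    using f F_swap[of x y] F_swap[of "N x" y] by simp_all
  define u where "u = N (N x2)"
  have u: "u \<noteq> 0" "N u = b *\<^sub>R u" using assms(5) by (simp_all add: u_def cubic)
  obtain v0 where v0: "F u v0 = 1" using dual_vector u by blast
  \<comment> \<open>\<open>N (N v0)\<close> lies in the eigenspace of \<open>u\<close>; the factor \<open>b\<^sup>-\<^sup>2\<close> makes it a projection, \<open>b\<^sup>-\<^sup>1\<close> scales\<close>
  define v where "v = (1 / b ^ 3) *\<^sub>R N (N v0)"
  have v: "F u v = 1 / b" "N v = b *\<^sub>R v"
    using v0 u b by (simp_all add: v_def cubic power2_eq_square power3_eq_cube)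
  have orth: "F a c = 0" "F c a = 0" if "N (N a) = 0" "N c = b *\<^sub>R c" for a c
  proof -
    have *: "F (N a') c = b * F a' c" for a'
      using selfadjoint[of a' c] that(2) by (simp del: selfadjoint)
    show "F a c = 0" using *[of a] *[of "N a"] that(1) b by simp
    then show "F c a = 0" using F_swap[of c a] by simp
  qed
  have kl: "Im (p * cnj (q + of_real (1 / b) * p)) \<noteq> 0"
    using pq by (simp add: algebra_simps)
  note o = orth[OF x(2) u(2)] orth[OF x(2) v(2)] orth[OF f(3) u(2)] orth[OF f(3) v(2)]
    orth[of "N x" u] orth[of "N x" v] orth[of "N y" u] orth[of "N y" v]
  show ?thesis
    by (rule D_realizes[OF kl, where ?v1.0 = "- N y" and ?v2.0 = "N x" and ?v3.0 = x
          and ?v4.0 = y and ?v5.0 = u and ?v6.0 = v])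
      (use b in \<open>simp add: D_def f g u v x o; simp add: field_simps\<close>)
qed

text \<open>On the plane of \<open>u\<^sub>i\<close> and \<open>v\<^sub>i\<close> the form \<open>D p q\<close> is the multiple \<open>p + r\<^sub>i q\<close> of the area form. Two of these
  complex numbers may agree, which gives \<open>r4\<close>. Otherwise the second is a real combination of the other
  two, which after rescaling becomes their sum, as in \<open>r6\<close>.\<close>
lemma three_eigenplanes:
  assumes pq: "Im (p * cnj q) \<noteq> 0" and "r1 \<noteq> r2"
    and N: "N u1 = r1 *\<^sub>R u1" "N v1 = r1 *\<^sub>R v1" "N u2 = r2 *\<^sub>R u2" "N v2 = r2 *\<^sub>R v2"
      "N u3 = r3 *\<^sub>R u3" "N v3 = r3 *\<^sub>R v3"
    and F: "F u1 v1 = 1" "F u2 v2 = 1" "F u3 v3 = 1"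
      "F u1 u2 = 0" "F u1 v2 = 0" "F v1 u2 = 0" "F v1 v2 = 0"
      "F u1 u3 = 0" "F u1 v3 = 0" "F v1 u3 = 0" "F v1 v3 = 0"
      "F u2 u3 = 0" "F u2 v3 = 0" "F v2 u3 = 0" "F v2 v3 = 0"
  shows "realizes (D p q) (ee 1 2) (ee 3 4 + ee 5 6) \<or>
    realizes (D p q) (ee 1 2 + ee 3 4) (ee 3 4 + ee 5 6)"
proof -
  have Im: "Im ((p + of_real a * q) * cnj (p + of_real b * q)) = (b - a) * Im (p * cnj q)" for a b
    by (simp add: algebra_simps)
  have F': "F u2 u1 = 0" "F v2 u1 = 0" "F u2 v1 = 0" "F v2 v1 = 0"
      "F u3 u1 = 0" "F v3 u1 = 0" "F u3 v1 = 0" "F v3 v1 = 0"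
      "F u3 u2 = 0" "F v3 u2 = 0" "F u3 v2 = 0" "F v3 v2 = 0"
    using F F_swap by (metis neg_equal_0_iff_equal)+
  consider "r3 = r1" | "r3 = r2" | "r3 \<noteq> r1" "r3 \<noteq> r2" by blast
  then show ?thesis
  proof cases
    case 1
    have "realizes (D p q) (ee 1 2) (ee 3 4 + ee 5 6)"
      by (rule D_realizes[where k = "p + of_real r2 * q" and l = "p + of_real r1 * q"
            and ?v1.0 = u2 and ?v2.0 = v2 and ?v3.0 = u1 and ?v4.0 = v1 and ?v5.0 = u3 and ?v6.0 = v3])
        (use pq assms(2) Im[of r2 r1] in simp, simp add: D_def N F F' 1 algebra_simps)
    then show ?thesis ..
  next
    case 2
    have "realizes (D p q) (ee 1 2) (ee 3 4 + ee 5 6)"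
      by (rule D_realizes[where k = "p + of_real r1 * q" and l = "p + of_real r2 * q"
            and ?v1.0 = u1 and ?v2.0 = v1 and ?v3.0 = u2 and ?v4.0 = v2 and ?v5.0 = u3 and ?v6.0 = v3])
        (use pq assms(2) Im[of r1 r2] in simp, simp add: D_def N F F' 2 algebra_simps)
    then show ?thesis ..
  next
    case 3
    define a where "a = (r3 - r2) / (r3 - r1)"
    define b where "b = (r2 - r1) / (r3 - r1)"
    have ab: "a + b = 1" "a * r1 + b * r3 = r2"
      using 3 by (simp_all add: a_def b_def add_divide_distrib[symmetric] divide_simps)
        (simp add: algebra_simps)
    have "a \<noteq> 0" "b \<noteq> 0" using 3 assms(2) by (simp_all add: a_def b_def)
    define k where "k = of_real a * (p + of_real r1 * q)"
    define l where "l = of_real b * (p + of_real r3 * q)"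
    have "k + l = of_real (a + b) * p + of_real (a * r1 + b * r3) * q"
      by (simp add: k_def l_def algebra_simps)
    then have kl: "p + of_real r2 * q = k + l" by (simp add: ab)
    have "Im (k * cnj l) = a * b * Im ((p + of_real r1 * q) * cnj (p + of_real r3 * q))"
      by (simp add: k_def l_def algebra_simps)
    then have Im_kl: "Im (k * cnj l) \<noteq> 0"
      using pq 3 \<open>a \<noteq> 0\<close> \<open>b \<noteq> 0\<close> by (simp only: Im) simp
    have D: "D p q u1 (a *\<^sub>R v1) = k" "D p q u3 (b *\<^sub>R v3) = l" "D p q u2 v2 = k + l"
      unfolding kl[symmetric] by (simp_all add: D_def N F k_def l_def algebra_simps)
    have "realizes (D p q) (ee 1 2 + ee 3 4) (ee 3 4 + ee 5 6)"
      by (rule D_realizes[OF Im_kl, where ?v1.0 = u1 and ?v2.0 = "a *\<^sub>R v1" and ?v3.0 = u2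
            and ?v4.0 = v2 and ?v5.0 = u3 and ?v6.0 = "b *\<^sub>R v3"], unfold D)
        (simp add: D_def N F F', simp add: algebra_simps)
    then show ?thesis ..
  qed
qed

text \<open>Lagrange interpolation: \<open>(N - s)(N - t)\<close> maps to the kernel of \<open>N - r\<close>, and acts there as the number
  \<open>(r - s)(r - t)\<close>.\<close>
lemma eigenprojection:
  assumes cubic: "\<And>x. N (N (N x)) =
      (r + s + t) *\<^sub>R N (N x) - (r * s + r * t + s * t) *\<^sub>R N x + (r * s * t) *\<^sub>R x"
    and "r \<noteq> s" "r \<noteq> t"
    and P: "\<And>x. P x = (1 / ((r - s) * (r - t))) *\<^sub>R (N (N x) - (s + t) *\<^sub>R N x + (s * t) *\<^sub>R x)"
  shows "N (P x) = r *\<^sub>R P x" and "F (P x) y = F x (P y)" and "N x = r *\<^sub>R x \<Longrightarrow> P x = x"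
proof -
  have "N (N (N x) - (s + t) *\<^sub>R N x + (s * t) *\<^sub>R x) =
      r *\<^sub>R (N (N x) - (s + t) *\<^sub>R N x + (s * t) *\<^sub>R x)"
    by (simp add: cubic algebra_simps)
  then show "N (P x) = r *\<^sub>R P x"
    unfolding P linear_cmul[OF N_linear] by (simp del: N_simps add: mult.commute)
  show "F (P x) y = F x (P y)"
    by (simp add: P)
  assume "N x = r *\<^sub>R x"
  then have "N (N x) - (s + t) *\<^sub>R N x + (s * t) *\<^sub>R x = ((r - s) * (r - t)) *\<^sub>R x"
    by (simp add: algebra_simps)
  then show "P x = x" using assms(2,3) by (simp add: P)
qed

lemma eigenprojections:
  assumes distinct: "a \<noteq> b" "a \<noteq> c" "b \<noteq> c"
    and cubic: "\<And>x. N (N (N x)) =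
      (a + b + c) *\<^sub>R N (N x) - (a * b + a * c + b * c) *\<^sub>R N x + (a * b * c) *\<^sub>R x"
  obtains P where
    "\<And>r x. r \<in> {a, b, c} \<Longrightarrow> N (P r x) = r *\<^sub>R P r x"
    "\<And>r x y. r \<in> {a, b, c} \<Longrightarrow> F (P r x) y = F x (P r y)"
    "\<And>r x. r \<in> {a, b, c} \<Longrightarrow> N x = r *\<^sub>R x \<Longrightarrow> P r x = x"
    "\<And>x. (\<Sum>r\<in>{a, b, c}. P r x) = x"
proof -
  define Q where "Q r s t x =
    (1 / ((r - s) * (r - t))) *\<^sub>R (N (N x) - (s + t) *\<^sub>R N x + (s * t) *\<^sub>R x)" for r s t x
  define P where "P r = (if r = a then Q a b c else if r = b then Q b a c else Q c a b)" for r
  note Qa = eigenprojection[OF cubic distinct(1,2) Q_def]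
  have cubic_b: "N (N (N x)) =
      (b + a + c) *\<^sub>R N (N x) - (b * a + b * c + a * c) *\<^sub>R N x + (b * a * c) *\<^sub>R x" for x
    by (simp add: cubic algebra_simps)
  have cubic_c: "N (N (N x)) =
      (c + a + b) *\<^sub>R N (N x) - (c * a + c * b + a * b) *\<^sub>R N x + (c * a * b) *\<^sub>R x" for x
    by (simp add: cubic algebra_simps)
  note Qb = eigenprojection[OF cubic_b distinct(1)[symmetric] distinct(3) Q_def]
  note Qc = eigenprojection[OF cubic_c distinct(2,3)[symmetric] Q_def]
  have sum: "Q a b c x + (Q b a c x + Q c a b x) = x" for x
  proof -
    \<comment> \<open>the interpolation weights over the common denominator \<open>d\<close>\<close>
    define d where "d = (a - b) * (a - c) * (b - c)"
    define k1 k2 k3 where k: "k1 = 1 / ((a - b) * (a - c))" "k2 = 1 / ((b - a) * (b - c))"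
      "k3 = 1 / ((c - a) * (c - b))"
    have "d \<noteq> 0" using distinct by (simp add: d_def)
    have k': "k1 = (b - c) / d" "k2 = (c - a) / d" "k3 = (a - b) / d"
      unfolding k d_def using distinct by (simp_all add: frac_eq_eq del: divide_eq_eq eq_divide_eq)
        (simp_all add: algebra_simps)
    have "k1 + k2 + k3 = 0"
      unfolding k' by (simp flip: add_divide_distrib)
    moreover have "k1 * (b + c) + k2 * (a + c) + k3 * (a + b) = 0"
      unfolding k' by (simp flip: add_divide_distrib) (simp add: algebra_simps)
    moreover have "k1 * (b * c) + k2 * (a * c) + k3 * (a * b) = 1"
      unfolding k' using \<open>d \<noteq> 0\<close> by (simp flip: add_divide_distrib) (simp add: d_def algebra_simps)
    moreover have "Q a b c x + (Q b a c x + Q c a b x) = (k1 + k2 + k3) *\<^sub>R N (N x) -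
        (k1 * (b + c) + k2 * (a + c) + k3 * (a + b)) *\<^sub>R N x +
        (k1 * (b * c) + k2 * (a * c) + k3 * (a * b)) *\<^sub>R x"
      unfolding Q_def k[symmetric] by (simp add: algebra_simps)
    ultimately show ?thesis by simp
  qed
  show ?thesis
  proof (rule that[of P])
    show "(\<Sum>r\<in>{a, b, c}. P r x) = x" for x
      using distinct sum[of x] by (simp add: P_def)
  qed (use distinct Qa Qb Qc in \<open>auto simp: P_def\<close>)
qed

text \<open>Eigenspaces are orthogonal and \<open>F\<close> is nondegenerate on each of them, so they are sums of hyperbolic
  planes. Two planes with different eigenvalues exist as \<open>N\<close> is not scalar; a component of a vector
  orthogonal to both yields the third.\<close>
lemma diagonalizable:
  assumes pq: "Im (p * cnj q) \<noteq> 0" and distinct: "a \<noteq> b" "a \<noteq> c" "b \<noteq> c"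
    and cubic: "\<And>x. N (N (N x)) =
      (a + b + c) *\<^sub>R N (N x) - (a * b + a * c + b * c) *\<^sub>R N x + (a * b * c) *\<^sub>R x"
    and nonscalar: "\<And>r. \<exists>x. N x \<noteq> r *\<^sub>R x"
  shows "realizes (D p q) (ee 1 2) (ee 3 4 + ee 5 6) \<or>
    realizes (D p q) (ee 1 2 + ee 3 4) (ee 3 4 + ee 5 6)"
proof -
  obtain P where
    eigen: "\<And>r x. r \<in> {a, b, c} \<Longrightarrow> N (P r x) = r *\<^sub>R P r x" and
    adj: "\<And>r x y. r \<in> {a, b, c} \<Longrightarrow> F (P r x) y = F x (P r y)" and
    fixed: "\<And>r x. r \<in> {a, b, c} \<Longrightarrow> N x = r *\<^sub>R x \<Longrightarrow> P r x = x" and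
    sum: "\<And>x. (\<Sum>r\<in>{a, b, c}. P r x) = x"
    using eigenprojections[OF distinct cubic] by blast
  have orth: "F x y = 0" if "N x = r *\<^sub>R x" "N y = s *\<^sub>R y" "r \<noteq> s" for x y r s
    using selfadjoint[of x y] that by (simp del: selfadjoint)
  have partner: "\<exists>v. F u v = 1 \<and> N v = r *\<^sub>R v" if "u \<noteq> 0" "N u = r *\<^sub>R u" "r \<in> {a, b, c}" for u r
  proof -
    obtain v where "F u v = 1" using dual_vector \<open>u \<noteq> 0\<close> by blast
    then have "F u (P r v) = 1" using adj[OF that(3), of u v] fixed[OF that(3,2)] by simp
    then show ?thesis using eigen[OF that(3)] by blast
  qed
  have "\<exists>r\<in>{a, b, c}. \<exists>s\<in>{a, b, c}. r \<noteq> s \<and> (\<exists>x. P r x \<noteq> 0) \<and> (\<exists>x. P s x \<noteq> 0)"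
  proof (rule ccontr)
    assume *: "\<not> ?thesis"
    obtain r where r: "r \<in> {a, b, c}" "\<And>s x. s \<in> {a, b, c} \<Longrightarrow> s \<noteq> r \<Longrightarrow> P s x = 0"
    proof (cases "\<exists>r\<in>{a, b, c}. \<exists>x. P r x \<noteq> 0")
      case True
      then show ?thesis using * that by blast
    next
      case False
      then show ?thesis using that[of a] by blast
    qed
    have "P r x = x" for x
      using sum[of x] r(2)[of _ x] sum.remove[OF _ r(1), of "\<lambda>r. P r x"] by simp
    then have "\<forall>x. N x = r *\<^sub>R x" using eigen[OF r(1)] by metis
    then show False using nonscalar[of r] by blast
  qed
  then obtain r1 r2 u1 u2 where r: "r1 \<in> {a, b, c}" "r2 \<in> {a, b, c}" "r1 \<noteq> r2"
    and u: "u1 \<noteq> 0" "N u1 = r1 *\<^sub>R u1" "u2 \<noteq> 0" "N u2 = r2 *\<^sub>R u2"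
    using eigen by metis
  obtain v1 v2 where v: "F u1 v1 = 1" "N v1 = r1 *\<^sub>R v1" "F u2 v2 = 1" "N v2 = r2 *\<^sub>R v2"
    using partner[OF u(1,2) r(1)] partner[OF u(3,4) r(2)] by blast
  obtain w where w: "w \<noteq> 0" "F w u1 = 0" "F w v1 = 0" "F w u2 = 0" "F w v2 = 0"
    using orthogonal_to_four by blast
  have "\<exists>r3\<in>{a, b, c}. P r3 w \<noteq> 0"
  proof (rule ccontr)
    assume "\<not> ?thesis"
    then have "(\<Sum>r\<in>{a, b, c}. P r w) = 0" by (intro sum.neutral) blast
    then show False using sum[of w] w(1) by simp
  qed
  then obtain r3 where r3: "r3 \<in> {a, b, c}" "P r3 w \<noteq> 0" by blast
  define u3 where "u3 = P r3 w"
  have u3: "u3 \<noteq> 0" "N u3 = r3 *\<^sub>R u3"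
    using r3 eigen by (simp_all add: u3_def)
  have u3_orth: "F u3 y = 0" if "N y = s *\<^sub>R y" "F w y = 0" for y s
  proof (cases "s = r3")
    case True
    then have "F u3 y = F w y" using that adj[OF r3(1), of w y] fixed[OF r3(1)] by (simp add: u3_def)
    then show ?thesis using that by simp
  next
    case False
    then show ?thesis using orth u3(2) that by metis
  qed
  obtain v0 where v0: "F u3 v0 = 1" "N v0 = r3 *\<^sub>R v0" using partner[OF u3 r3(1)] by blast
  \<comment> \<open>the component of \<open>v0\<close> orthogonal to the first two planes; the correction stays in the eigenspace,
    since eigenvectors for other eigenvalues come with coefficient \<open>0\<close>\<close>
  define v3 where
    "v3 = v0 - F u1 v0 *\<^sub>R v1 + F v1 v0 *\<^sub>R u1 - F u2 v0 *\<^sub>R v2 + F v2 v0 *\<^sub>R u2"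
  have zero: "F y v0 = 0 \<or> s = r3" if "N y = s *\<^sub>R y" for y s
    using orth[OF that v0(2)] by blast
  have "N v3 = r3 *\<^sub>R v3"
    using zero[OF u(2)] zero[OF u(4)] zero[OF v(2)] zero[OF v(4)]
    by (auto simp: v3_def v0 u v algebra_simps)
  moreover have f: "F u1 u2 = 0" "F u1 v2 = 0" "F v1 u2 = 0" "F v1 v2 = 0"
    using orth u v r(3) by metis+
  moreover have g: "F v1 u1 = - 1" "F v2 u2 = - 1" "F u2 u1 = 0" "F v2 u1 = 0" "F u2 v1 = 0" "F v2 v1 = 0"
    using f v F_swap by (metis neg_equal_0_iff_equal)+
  moreover have h: "F u3 u1 = 0" "F u3 v1 = 0" "F u3 u2 = 0" "F u3 v2 = 0"
    using u3_orth w u v by blast+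
  moreover have "F u1 u3 = 0" "F v1 u3 = 0" "F u2 u3 = 0" "F v2 u3 = 0"
    using h F_swap by (metis neg_equal_0_iff_equal)+
  moreover have "F u3 v3 = 1" "F u1 v3 = 0" "F v1 v3 = 0" "F u2 v3 = 0" "F v2 v3 = 0"
    using f g h v0 v by (simp_all add: v3_def)
  ultimately show ?thesis
    using three_eigenplanes[OF pq r(3), of u1 v1 u2 v2 u3 r3 v3] u v u3 by simp
qed

text \<open>On the kernel \<open>W\<close> of \<open>N\<^sup>2 + b N + c\<close> the operator \<open>J = (N + b / 2) / d\<close> squares to \<open>-1\<close> and is self-adjoint.
  In \<open>r5\<close> only the first form is nonzero on \<open>e\<^sup>5\<^sup>6\<close>, and the quotient of the two forms on \<open>e\<^sup>1, \<dots>, e\<^sup>4\<close> is a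
  multiple of a complex structure. This is achieved by the member \<open>G x y = F x y + \<beta> F (N x) y\<close> of the pencil, because
  \<open>N (J x) = - \<kappa> (x + \<beta> N x)\<close> on \<open>W\<close> for \<open>\<beta> = b / (2 c)\<close> and \<open>\<kappa> = c / d\<close>; thus the second form is
  \<open>\<kappa> G (J x) y\<close>.\<close>
lemma complex_roots:
  assumes pq: "Im (p * cnj q) \<noteq> 0" and disc: "b\<^sup>2 < 4 * c"
    and cubic: "\<And>x. N (N (N x)) = - b *\<^sub>R N (N x) - c *\<^sub>R N x"
    and u: "u \<noteq> 0" "N u = 0" and "N x0 \<noteq> 0"
  shows "realizes (D p q) (ee 1 3 + ee 2 4 + ee 5 6) (ee 1 4 - ee 2 3)"
proof -
  have c: "c > 0" using disc zero_le_power2[of b] by linarith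
  define d where "d = sqrt (c - b\<^sup>2 / 4)"
  have d: "d > 0" "d * d = c - b\<^sup>2 / 4"
    using disc by (simp_all add: d_def)
  define \<beta> where "\<beta> = b / (2 * c)"
  define \<kappa> where "\<kappa> = c / d"
  define l where "l = of_real \<kappa> * (q - of_real \<beta> * p)"
  have \<kappa>: "\<kappa> > 0" using c d by (simp add: \<kappa>_def)
  define W where "W = {x. N (N x) = - b *\<^sub>R N x - c *\<^sub>R x}"
  define J where "J x = (1 / d) *\<^sub>R (N x + (b / 2) *\<^sub>R x)" for x
  define G where "G x y = F x y + \<beta> * F (N x) y" for x y
  have W: "N (N x) = - b *\<^sub>R N x - c *\<^sub>R x" if "x \<in> W" for x using that by (simp add: W_def)
  have J_W: "J x \<in> W" if "x \<in> W" for x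
  proof -
    have "N (N (J x)) + b *\<^sub>R N (J x) + c *\<^sub>R J x =
        J (N (N x) + b *\<^sub>R N x + c *\<^sub>R x)"
      by (simp add: J_def algebra_simps)
    also have "N (N x) + b *\<^sub>R N x + c *\<^sub>R x = 0"
      by (simp add: W[OF that])
    finally show ?thesis
      by (simp add: W_def J_def algebra_simps eq_neg_iff_add_eq_0)
  qed
  have neg: "- x \<in> W" "J (- x) = - J x" if "x \<in> W" for x
    by (simp_all add: W[OF that] W_def J_def algebra_simps)
  have JJ: "J (J x) = - x" if "x \<in> W" for x
  proof -
    have "J (J x) = (1 / (d * d)) *\<^sub>R (N (N x) + b *\<^sub>R N x + (b\<^sup>2 / 4) *\<^sub>R x)"
      by (simp add: J_def algebra_simps power2_eq_square flip: scaleR_left_distrib)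
    also have "\<dots> = (1 / (d * d)) *\<^sub>R (- (d * d) *\<^sub>R x)"
      unfolding W[OF that] d(2) by (simp add: algebra_simps)
    finally show ?thesis using d(1) by simp
  qed
  have NJ: "N (J x) = - \<kappa> *\<^sub>R (x + \<beta> *\<^sub>R N x)" if "x \<in> W" for x
  proof -
    have "N (J x) = (1 / d) *\<^sub>R (N (N x) + (b / 2) *\<^sub>R N x)"
      by (simp add: J_def)
    also have "\<dots> = (1 / d) *\<^sub>R (- c *\<^sub>R x - (b / 2) *\<^sub>R N x)"
      unfolding W[OF that] by (simp add: algebra_simps flip: scaleR_left_distrib)
    finally show ?thesis using c d by (simp add: \<kappa>_def \<beta>_def algebra_simps)
  qed
  have G_lin: "G x (y + z) = G x y + G x z" "G x (r *\<^sub>R y) = r * G x y" "G x (- y) = - G x y"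
    "G (- x) y = - G x y" for x y z r
    by (simp_all add: G_def algebra_simps)
  have G_alt: "G x x = 0" "G (J x) x = 0" for x
    by (simp_all add: G_def J_def)
  have GJ: "G x (J y) = G (J x) y" for x y
    by (simp add: G_def J_def)
  have FG: "F (N x) y = \<kappa> * G (J x) y" if "x \<in> W" for x y
    using NJ[OF J_W[OF that]] JJ[OF that] by (simp add: G_def)
  have D_W: "D p q x y = of_real (G x y) * p + of_real (G (J x) y) * l" if "x \<in> W" for x y
  proof -
    have F: "F x y = G x y - \<beta> * \<kappa> * G (J x) y" by (simp only: G_def[of x y] FG[OF that])
    show ?thesis unfolding D_def FG[OF that] F l_def by (simp add: algebra_simps)
  qed
  have orth: "F x y = 0" "F y x = 0" if "x \<in> W" "N y = 0" for x y
  proof -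
    have "F (N x) y = 0" "F (N (N x)) y = 0" using that(2) selfadjoint[of x y] selfadjoint[of "N x" y]
      by (simp_all del: selfadjoint)
    then show "F x y = 0" using W[OF that(1)] c by simp
    then show "F y x = 0" using F_swap[of y x] by simp
  qed
  have G_orth: "G x y = 0" if "x \<in> W" "N y = 0" for x y
    using orth[OF that] that(2) selfadjoint[of x y] by (simp add: G_def del: selfadjoint)
  obtain v0 where v0: "F u v0 = 1" using dual_vector u by blast
  define v where "v = (1 / c) *\<^sub>R (N (N v0) + b *\<^sub>R N v0 + c *\<^sub>R v0)"
  have v: "F u v = 1" "N v = 0"
    using v0 u c by (simp_all add: v_def cubic)
  define x where "x = N x0"
  have x: "x \<noteq> 0" "x \<in> W" using assms(6) by (simp_all add: x_def W_def cubic)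
  \<comment> \<open>\<open>X\<close> is defined by \<open>G x y = F X y\<close>, so a vector dual to \<open>x\<close> for \<open>G\<close> is one dual to \<open>X\<close> for \<open>F\<close>\<close>
  define X where "X = x + \<beta> *\<^sub>R N x"
  have "X \<noteq> 0"
  proof
    assume "X = 0"
    then have "N (J x) = 0" using NJ[OF x(2)] by (simp add: X_def)
    then have "J x = 0" using W[OF J_W[OF x(2)]] c by simp
    moreover have "J 0 = 0" by (simp add: J_def)
    ultimately show False using JJ[OF x(2)] x(1) by simp
  qed
  then obtain z0 where z0: "F X z0 = 1" using dual_vector by blast
  \<comment> \<open>the projection of \<open>z0\<close> onto \<open>W\<close>\<close>
  define z where "z = (- 1 / c) *\<^sub>R (N (N z0) + b *\<^sub>R N z0)"
  have z_W: "z \<in> W" by (simp add: W_def z_def cubic algebra_simps)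
  have "F X z = (- 1 / c) * F (N (N X) + b *\<^sub>R N X) z0" by (simp add: z_def)
  also have "N (N X) + b *\<^sub>R N X = - c *\<^sub>R X"
    by (simp add: X_def W[OF x(2)] algebra_simps)
  finally have "G x z = 1" using z0 c by (simp add: G_def X_def)
  define t where "t = G (J x) z"
  \<comment> \<open>as \<open>G (J x) (J z) = - 1\<close>, the combination with \<open>J z\<close> removes the value \<open>t\<close> of \<open>G (J x)\<close>; the factor
    restores \<open>G x y = 1\<close>\<close>
  define y where "y = (1 / (1 + t\<^sup>2)) *\<^sub>R (z + t *\<^sub>R J z)"
  have y_W: "y \<in> W" 
    unfolding W_def by (simp add: y_def W[OF z_W] W[OF J_W[OF z_W]] algebra_simps)
  have nz: "1 + t\<^sup>2 \<noteq> 0" by (metis add_pos_nonneg less_irrefl zero_le_power2 zero_less_one)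
  have y: "G x y = 1" "G (J x) y = 0"
    using \<open>G x z = 1\<close> nz by (simp_all add: y_def G_lin GJ JJ[OF x(2)] t_def[symmetric]
        power2_eq_square)
  have kl: "Im (p * cnj l) \<noteq> 0"
    using pq \<kappa> by (simp add: l_def algebra_simps)
  show ?thesis
    by (rule D_realizes[OF kl, where ?v1.0 = x and ?v2.0 = "J x" and ?v3.0 = y
          and ?v4.0 = "- J y" and ?v5.0 = u and ?v6.0 = v])
      (simp add: D_W x y_W J_W neg G_lin G_alt G_orth GJ JJ y u v, simp add: D_def u v algebra_simps)
qed

section \<open>Classification of the pencils\<close>

text \<open>The Jordan types that are compatible with the roots \<open>0, 0, b\<close> of the cubic, distinguished by the minimal
  polynomial of \<open>N\<close>.\<close>
lemma double_root:
  assumes pq: "Im (p * cnj q) \<noteq> 0" and nonscalar: "\<And>r. \<exists>x. N x \<noteq> r *\<^sub>R x"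
    and cubic: "\<And>x. N (N (N x)) = b *\<^sub>R N (N x)"
  shows "in_list (D p q)"
proof -
  obtain x where x: "N x \<noteq> 0" using nonscalar[of 0] by auto
  consider "\<And>x. N (N x) = 0" | y where "b = 0" "N (N y) \<noteq> 0"
    | "b \<noteq> 0" "\<And>x. N (N x) = b *\<^sub>R N x"
    | x1 x2 where "b \<noteq> 0" "N (N x1) \<noteq> b *\<^sub>R N x1" "N (N x2) \<noteq> 0"
    by blast
  then show ?thesis
  proof cases
    case 1
    then show ?thesis using square_zero[OF pq _ x] by (simp add: in_list_def)
  next
    case 2
    then show ?thesis using cube_zero[OF pq _ 2(2)] cubic by (simp add: in_list_def)
  next
    case 3
    \<comment> \<open>any third root different from \<open>0\<close> and \<open>b\<close> will do\<close>
    have "realizes (D p q) (ee 1 2) (ee 3 4 + ee 5 6) \<or>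
        realizes (D p q) (ee 1 2 + ee 3 4) (ee 3 4 + ee 5 6)"
      by (rule diagonalizable[OF pq, of 0 b "- b"]) (use 3 nonscalar in auto)
    then show ?thesis by (auto simp: in_list_def)
  next
    case 4
    then show ?thesis using double_and_simple_root[OF pq 4(1) cubic 4(2,3)] by (simp add: in_list_def)
  qed
qed

text \<open>With \<open>0\<close> an eigenvalue, the discriminant of the remaining quadratic factor decides between nonreal and real roots,
  and a double root among the real ones is moved to \<open>0\<close>. In the nonreal case the kernel vector \<open>u\<close> is needed since the
  cubic need not be the minimal polynomial a priori.\<close>
lemma singular_pencil:
  assumes pq: "Im (p * cnj q) \<noteq> 0" and nonscalar: "\<And>r. \<exists>x. N x \<noteq> r *\<^sub>R x"
    and cubic: "\<And>x. N (N (N x)) = - b *\<^sub>R N (N x) - c *\<^sub>R N x"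
    and u: "u \<noteq> 0" "N u = 0"
  shows "in_list (D p q)"
proof (cases "b\<^sup>2 < 4 * c")
  case True
  obtain x where "N x \<noteq> 0" using nonscalar[of 0] by auto
  then show ?thesis using complex_roots[OF pq True cubic u] by (simp add: in_list_def)
next
  case False
  define r where "r = (- b + sqrt (b\<^sup>2 - 4 * c)) / 2"
  define s where "s = (- b - sqrt (b\<^sup>2 - 4 * c)) / 2"
  have rs: "r + s = - b" by (simp add: r_def s_def field_simps)
  have "r * s = (b\<^sup>2 - (sqrt (b\<^sup>2 - 4 * c))\<^sup>2) / 4"
    by (simp add: r_def s_def field_simps power2_eq_square)
  then have rs': "r * s = c" using False by simp
  have cubic': "N (N (N x)) = (r + s) *\<^sub>R N (N x) - (r * s) *\<^sub>R N x" for x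
    by (simp add: cubic rs rs')
  consider "r = 0 \<or> s = 0" | "r \<noteq> 0" "s = r" | "r \<noteq> 0" "s \<noteq> 0" "r \<noteq> s" by blast
  then show ?thesis
  proof cases
    case 1
    then have "r * s = 0" by auto
    then show ?thesis using double_root[OF pq nonscalar, of "r + s"] cubic' by simp
  next
    case 2
    interpret shifted: symplectic_pencil F "\<lambda>x. N x - r *\<^sub>R x" by (rule shift)
    have "\<exists>x. N x - r *\<^sub>R x \<noteq> a *\<^sub>R x" for a
      using nonscalar[of "r + a"] by (auto simp: algebra_simps)
    moreover have "Im ((p + of_real r * q) * cnj q) \<noteq> 0"
      using pq by (simp add: algebra_simps)
    moreover have "N (N (N x)) = r *\<^sub>R N (N x) + r *\<^sub>R N (N x) - (r * r) *\<^sub>R N x" for x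
      using cubic'[of x] 2 by (simp only: scaleR_left_distrib)
    ultimately show ?thesis
      unfolding D_shift[of p q r]
      by (intro shifted.double_root[of _ _ "- r"]) (auto simp: algebra_simps)
  next
    case 3
    have "realizes (D p q) (ee 1 2) (ee 3 4 + ee 5 6) \<or>
        realizes (D p q) (ee 1 2 + ee 3 4) (ee 3 4 + ee 5 6)"
      by (rule diagonalizable[OF pq, of 0 r s]) (use 3 nonscalar cubic' in auto)
    then show ?thesis by (auto simp: in_list_def)
  qed
qed

text \<open>The shift by the real eigenvalue \<open>r\<close> reduces to a cubic with vanishing constant coefficient.\<close>
theorem symplectic_pencil_in_list:
  assumes pq: "Im (p * cnj q) \<noteq> 0" and nonscalar: "\<And>r. \<exists>x. N x \<noteq> r *\<^sub>R x"
    and cubic: "\<And>x. N (N (N x)) = t *\<^sub>R N (N x) - m *\<^sub>R N x + k *\<^sub>R x"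
    and u: "u \<noteq> 0" "N u = r *\<^sub>R u"
  shows "in_list (D p q)"
proof -
  interpret shifted: symplectic_pencil F "\<lambda>x. N x - r *\<^sub>R x" by (rule shift)
  have "(r * r * r - (t * (r * r) - m * r + k)) *\<^sub>R u = 0"
    using cubic[of u] by (simp add: u(2) algebra_simps)
  then have k: "k = r * r * r - t * (r * r) + m * r" using u(1) by simp
  \<comment> \<open>polynomials of degree at most two in \<open>N\<close>, applied to \<open>x\<close>: on their coefficients the identity to be shown is one
    between real numbers\<close>
  define C where "C \<alpha> \<beta> \<gamma> x = \<alpha> *\<^sub>R N (N x) + \<beta> *\<^sub>R N x + \<gamma> *\<^sub>R x" for \<alpha> \<beta> \<gamma> x
  define N' where "N' x = N x - r *\<^sub>R x" for x
  have C_shift: "N' (C \<alpha> \<beta> \<gamma> x) =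
      C (\<alpha> * t + \<beta> - r * \<alpha>) (\<gamma> - \<alpha> * m - r * \<beta>) (\<alpha> * k - r * \<gamma>) x" for \<alpha> \<beta> \<gamma> x
    unfolding C_def N'_def by (simp add: cubic algebra_simps)
  have C_lin: "a *\<^sub>R C \<alpha> \<beta> \<gamma> x = C (a * \<alpha>) (a * \<beta>) (a * \<gamma>) x"
    "C \<alpha> \<beta> \<gamma> x - C \<alpha>' \<beta>' \<gamma>' x = C (\<alpha> - \<alpha>') (\<beta> - \<beta>') (\<gamma> - \<gamma>') x" for a \<alpha> \<beta> \<gamma> \<alpha>' \<beta>' \<gamma>' x
    unfolding C_def by (simp_all add: algebra_simps)
  have C_id: "C 0 0 1 x = x" for x
    by (simp add: C_def)
  have "N' (N' (N' (C 0 0 1 x))) = - (3 * r - t) *\<^sub>R N' (N' (C 0 0 1 x)) -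
      (3 * r * r - 2 * t * r + m) *\<^sub>R N' (C 0 0 1 x)" for x
    unfolding C_shift C_lin by (simp add: k algebra_simps)
  moreover have "\<exists>x. N x - r *\<^sub>R x \<noteq> a *\<^sub>R x" for a
    using nonscalar[of "r + a"] by (auto simp: algebra_simps)
  moreover have "Im ((p + of_real r * q) * cnj q) \<noteq> 0"
    using pq by (simp add: algebra_simps)
  ultimately show ?thesis
    unfolding D_shift[of p q r]
    by (rule_tac shifted.singular_pencil[of _ _ "3 * r - t" "3 * r * r - 2 * t * r + m" u])
      (use u in \<open>simp_all add: C_id N'_def\<close>)
qed

end
section \<open>Hermitian pencils\<close>

text \<open>The sesquilinear form \<open>x\<^sup>T H cnj y\<close>. In this shape a matrix acts on the left argument by multiplication
  of \<open>transpose H\<close>.\<close>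
definition sesq :: "complex^'n^'n \<Rightarrow> complex^'n \<Rightarrow> complex^'n \<Rightarrow> complex" where
  "sesq H x y = (\<Sum>k\<in>UNIV. (transpose H *v x) $ k * cnj (y $ k))"

text \<open>The differential of \<open>\<omega>\<^sup>n\<close> in the structure \<open>J\<^sub>M\<close>, as a two-form on the space with coordinates \<open>\<omega>\<^sup>1, \<dots>, \<omega>\<^sup>n\<^sup>-\<^sup>1\<close>.\<close>
definition matrix_form :: "complex^'n^'n \<Rightarrow> complex^'n \<Rightarrow> complex^'n \<Rightarrow> complex" where
  "matrix_form M x y = (\<Sum>j\<in>UNIV. \<Sum>k\<in>UNIV. M $ j $ k * (x $ j * cnj (y $ k) - y $ j * cnj (x $ k)))"

lemma sesq_entries: "sesq H x y = (\<Sum>j\<in>UNIV. \<Sum>k\<in>UNIV. H $ j $ k * x $ j * cnj (y $ k))"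
  unfolding sesq_def matrix_vector_mult_def transpose_def
  by (simp add: sum_distrib_right) (rule sum.swap)

lemma matrix_form_sesq: "matrix_form M x y = sesq M x y - sesq M y x"
  by (simp add: matrix_form_def sesq_entries algebra_simps sum_subtractf)

lemma hermitian_entry:
  assumes "hermitian_matrix H"
  shows "H $ j $ k = cnj (H $ k $ j)"
proof -
  have "H $ j $ k = map_matrix cnj (transpose H) $ j $ k"
    using assms unfolding hermitian_matrix_def by (rule arg_cong)
  also have "\<dots> = cnj (H $ k $ j)"
    by (simp add: transpose_def)
  finally show ?thesis .
qed

lemma hermitian_matrixI:
  assumes "\<And>j k. H $ j $ k = cnj (H $ k $ j)"
  shows "hermitian_matrix H"
proof -
  have "H $ j $ k = map_matrix cnj (transpose H) $ j $ k" for j k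
    by (subst assms) (simp add: transpose_def)
  then show ?thesis unfolding hermitian_matrix_def vec_eq_iff by blast
qed

lemma sesq_hermitian:
  assumes "hermitian_matrix H"
  shows "sesq H y x = cnj (sesq H x y)"
proof -
  have "cnj (sesq H x y) = (\<Sum>j\<in>UNIV. \<Sum>k\<in>UNIV. H $ k $ j * cnj (x $ j) * y $ k)"
    unfolding sesq_entries cnj_sum by (simp flip: hermitian_entry[OF assms])
  also have "\<dots> = sesq H y x"
    unfolding sesq_entries by (subst sum.swap) (simp add: mult_ac)
  finally show ?thesis ..
qed

lemma matrix_form_hermitian:
  assumes "hermitian_matrix H"
  shows "matrix_form H x y = 2 * \<i> * of_real (Im (sesq H x y))"
  unfolding matrix_form_sesq sesq_hermitian[OF assms, of y x] by (simp add: complex_eq_iff)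

lemma sesq_add: "sesq (A + B) x y = sesq A x y + sesq B x y"
  by (simp add: sesq_entries algebra_simps sum.distrib)

lemma sesq_scale: "sesq (map_matrix ((*) c) A) x y = c * sesq A x y"
  by (simp add: sesq_entries sum_distrib_left mult_ac)

lemma bilinear_sesq: "bilinear (sesq H)"
proof -
  have "sesq H x (y + z) = sesq H x y + sesq H x z" "sesq H (x + y) z = sesq H x z + sesq H y z" for x y z
    by (simp_all add: sesq_entries distrib_left distrib_right sum.distrib)
  moreover have "sesq H x (r *\<^sub>R y) = r *\<^sub>R sesq H x y" "sesq H (r *\<^sub>R x) y = r *\<^sub>R sesq H x y"
    for r x y
    by (simp_all add: sesq_entries scaleR_sum_right)
  ultimately show ?thesis
    unfolding bilinear_def by (auto intro!: linearI)
qed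

lemma sesq_times_ii: "sesq H x (\<chi> k. \<i> * y $ k) = - \<i> * sesq H x y"
  unfolding sesq_entries sum_distrib_left
  by (intro sum.cong refl) simp

lemma sesq_axis_right: "sesq H x (axis k 1) = (transpose H *v x) $ k"
  by (simp add: sesq_def axis_def if_distrib[of cnj] if_distrib[of "(*) _"] cong: if_cong)

lemma sesq_axis: "sesq H (axis j 1) (axis k 1) = H $ j $ k"
  unfolding sesq_axis_right
  by (simp add: matrix_vector_mult_def transpose_def axis_def if_distrib[of "(*) _"]
      del: transpose_matrix_vector cong: if_cong)

lemma sesq_nondegenerate:
  assumes "invertible H" and "\<And>y. Im (sesq H x y) = 0"
  shows "x = 0"
proof -
  have "sesq H x y = 0" for y
    using assms(2)[of y] assms(2)[of "\<chi> k. \<i> * y $ k"] unfolding sesq_times_ii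
    by (simp add: complex_eq_iff)
  then have "transpose H *v x = 0"
    unfolding vec_eq_iff sesq_axis_right[symmetric] by simp
  moreover have "invertible (transpose H)"
    using assms(1) by (simp add: invertible_det_nz)
  ultimately show ?thesis
    by (meson invertible_left_inverse matrix_left_invertible_ker)
qed

text \<open>A cubic polynomial in \<open>z\<close> is determined by its extreme coefficients and its values at \<open>1\<close> and \<open>-1\<close>, which gives
  the two others.\<close>
lemma det_pencil_3:
  fixes A B :: "complex^3^3"
  obtains d1 d2 where "\<And>z. det (A + map_matrix ((*) z) B) = det A + d1 * z + d2 * z\<^sup>2 + det B * z ^ 3"
proof -
  define d1 d2 where "d1 = (det (A + B) - det (A - B)) / 2 - det B"
    and "d2 = (det (A + B) + det (A - B)) / 2 - det A"
  have *: "2 * det (A + map_matrix ((*) z) B) = 2 * det A +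
      (det (A + B) - det (A - B) - 2 * det B) * z +
      (det (A + B) + det (A - B) - 2 * det A) * z\<^sup>2 + 2 * det B * z ^ 3" for z
    unfolding det_3 power2_eq_square power3_eq_cube by (simp add: algebra_simps)
  have "det (A + map_matrix ((*) z) B) = det A + d1 * z + d2 * z\<^sup>2 + det B * z ^ 3" for z
  proof -
    have "2 * det (A + map_matrix ((*) z) B) =
        2 * det A + (2 * d1) * z + (2 * d2) * z\<^sup>2 + 2 * det B * z ^ 3"
      unfolding * d1_def d2_def
      by (simp add: diff_divide_distrib add_divide_distrib right_diff_distrib distrib_left)
    also have "\<dots> = 2 * (det A + d1 * z + d2 * z\<^sup>2 + det B * z ^ 3)"
      by (simp add: algebra_simps)
    finally show ?thesis
      by (rule mult_left_cancel[THEN iffD1, rotated]) (rule zero_neq_numeral[symmetric])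
  qed
  then show ?thesis using that by blast
qed

lemma hermitian_det_real:
  fixes H :: "complex^3^3"
  assumes "hermitian_matrix H"
  shows "Im (det H) = 0"
proof -
  note h = hermitian_entry[OF assms]
  have "cnj (det H) = det H"
    unfolding det_3 h[of 2 1] h[of 3 1] h[of 3 2]
    by (simp add: h[of 1 1, symmetric] h[of 2 2, symmetric] h[of 3 3, symmetric] mult_ac)
  then show ?thesis by (simp add: complex_eq_iff)
qed

lemma cayley_hamilton_3:
  fixes K :: "complex^3^3"
  obtains t m where
    "\<And>x. K *v (K *v (K *v x)) = t *s (K *v (K *v x)) - m *s (K *v x) + det K *s x"
    "\<And>z. det (mat z - K) = z ^ 3 - t * z\<^sup>2 + m * z - det K"
proof (rule that)
  define t where "t = K$1$1 + K$2$2 + K$3$3"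
  define m where "m = K$1$1 * K$2$2 - K$1$2 * K$2$1 + K$1$1 * K$3$3 - K$1$3 * K$3$1 +
    K$2$2 * K$3$3 - K$2$3 * K$3$2"
  show "K *v (K *v (K *v x)) = t *s (K *v (K *v x)) - m *s (K *v x) + det K *s x" for x
    unfolding vec_eq_iff forall_3 det_3 t_def m_def
    by (simp add: matrix_vector_mult_def sum_3) (intro conjI; algebra)
  show "det (mat z - K) = z ^ 3 - t * z\<^sup>2 + m * z - det K" for z
    unfolding det_3 t_def m_def by (simp add: mat_def) algebra
qed

text \<open>Outside the interval of radius \<open>1 + \<bar>t\<bar> + \<bar>m\<bar> + \<bar>k\<bar>\<close> the cubic term dominates, and the intermediate value theorem applies.\<close>
lemma real_cubic_root:
  fixes t m k :: real
  obtains r where "r ^ 3 - t * r\<^sup>2 + m * r - k = 0"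
proof -
  define S where "S = \<bar>t\<bar> + \<bar>m\<bar> + \<bar>k\<bar>"
  define f where "f r = r ^ 3 - (t * r\<^sup>2 - m * r + k)" for r
  have lower: "\<bar>t * r\<^sup>2 - m * r + k\<bar> \<le> S * r\<^sup>2" if "\<bar>r\<bar> \<ge> 1" for r
  proof -
    have "\<bar>r\<bar> \<le> r\<^sup>2" "1 \<le> r\<^sup>2"
      using that mult_left_mono[of 1 "\<bar>r\<bar>" "\<bar>r\<bar>"] by (simp_all add: power2_eq_square abs_le_square_iff[of 1])
    then have "\<bar>m * r\<bar> \<le> \<bar>m\<bar> * r\<^sup>2" "\<bar>k\<bar> \<le> \<bar>k\<bar> * r\<^sup>2"
      using mult_left_mono[of "\<bar>r\<bar>" "r\<^sup>2" "\<bar>m\<bar>"] mult_left_mono[of 1 "r\<^sup>2" "\<bar>k\<bar>"]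
      by (simp_all add: abs_mult)
    moreover have "\<bar>t * r\<^sup>2\<bar> = \<bar>t\<bar> * r\<^sup>2" by (simp add: abs_mult)
    ultimately show ?thesis unfolding S_def distrib_right by linarith
  qed
  have cube: "(1 + S) ^ 3 = S * (1 + S)\<^sup>2 + (1 + S)\<^sup>2" "(- 1 - S) ^ 3 = - ((1 + S) ^ 3)"
      "(- 1 - S)\<^sup>2 = (1 + S)\<^sup>2"
    by (simp_all add: power2_eq_square power3_eq_cube algebra_simps)
  have S: "S \<ge> 0" by (simp add: S_def)
  have "f (1 + S) \<ge> 0" "f (- 1 - S) \<le> 0"
    using lower[of "1 + S"] lower[of "- 1 - S"] S zero_le_power2[of "1 + S"]
    unfolding f_def cube by linarith+
  moreover have "continuous_on {- 1 - S..1 + S} f"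
    unfolding f_def by (intro continuous_intros)
  ultimately obtain r where "f r = 0"
    using IVT'[of f "- 1 - S" 0 "1 + S"] S by auto
  then show ?thesis using that by (simp add: f_def algebra_simps)
qed

text \<open>The determinant of \<open>A0 + z B\<close> is a polynomial in \<open>z\<close>, nonzero at \<open>\<i>\<close>. It is therefore nonzero at some real \<open>t\<close>.\<close>
lemma hermitian_pencil_3:
  fixes M :: "complex^3^3"
  assumes "invertible M"
  obtains A B :: "complex^3^3" and t :: real where
    "hermitian_matrix A" "hermitian_matrix B" "invertible A"
    "M = A + map_matrix ((*) (\<i> - of_real t)) B"
proof -
  \<comment> \<open>\<open>M = A0 + \<i> B\<close> is the decomposition into Hermitian parts\<close>
  define A0 :: "complex^3^3" where "A0 = (\<chi> j k. (M $ j $ k + cnj (M $ k $ j)) / 2)"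
  define B :: "complex^3^3" where "B = (\<chi> j k. \<i> * (cnj (M $ k $ j) - M $ j $ k) / 2)"
  have A0: "A0 $ j $ k = cnj (A0 $ k $ j)" and B_entry: "B $ j $ k = cnj (B $ k $ j)" for j k
    by (simp_all add: A0_def B_def complex_eq_iff algebra_simps)
  have herm: "hermitian_matrix (A0 + map_matrix ((*) (of_real s)) B)" for s
    by (rule hermitian_matrixI) (simp flip: A0 B_entry)
  have B: "hermitian_matrix B"
    by (rule hermitian_matrixI) (simp flip: B_entry)
  have M: "M = A0 + map_matrix ((*) \<i>) B"
    by (simp add: vec_eq_iff A0_def B_def field_simps)
  obtain d1 d2 where d: "\<And>z. det (A0 + map_matrix ((*) z) B) = det A0 + d1 * z + d2 * z\<^sup>2 + det B * z ^ 3"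
    using det_pencil_3[of A0 B] by blast
  have "\<exists>t::real. det (A0 + map_matrix ((*) (of_real t)) B) \<noteq> 0"
  proof (rule ccontr)
    assume "\<not> ?thesis"
    then have zero: "det A0 + d1 * of_real t + d2 * (of_real t)\<^sup>2 + det B * (of_real t) ^ 3 = 0" for t :: real
      unfolding d by blast
    have "det A0 = 0" using zero[of 0] by simp
    then have z: "d1 + d2 + det B = 0"
      using zero[of 1] by simp
    have "d2 - d1 - det B = d1 * (- 1) + d2 * (- 1)\<^sup>2 + det B * (- 1) ^ 3"
      by simp
    then have z': "d2 - d1 - det B = 0"
      using zero[of "- 1"] \<open>det A0 = 0\<close> by simp
    have "2 * d1 + 4 * d2 + 8 * det B = d1 * 2 + d2 * 2\<^sup>2 + det B * 2 ^ 3"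
      by simp
    then have z'': "2 * d1 + 4 * d2 + 8 * det B = 0"
      using zero[of 2] \<open>det A0 = 0\<close> by (simp add: mult.commute)
    have "2 * d2 = (d1 + d2 + det B) + (d2 - d1 - det B)" by simp
    then have "d2 = 0" unfolding z z' by simp
    have "6 * det B = (2 * d1 + 4 * d2 + 8 * det B) - 2 * (d1 + d2 + det B) - 2 * d2" by simp
    then have "det B = 0" unfolding z z'' by (simp add: \<open>d2 = 0\<close>)
    then have "d1 = 0" using z \<open>d2 = 0\<close> by simp
    have "det M = 0" unfolding M d \<open>det A0 = 0\<close> \<open>d1 = 0\<close> \<open>d2 = 0\<close> \<open>det B = 0\<close> by simp
    then show False using assms by (simp add: invertible_det_nz)
  qed
  then obtain t :: real where t: "det (A0 + map_matrix ((*) (of_real t)) B) \<noteq> 0" by blast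
  show ?thesis
  proof (rule that[OF herm[of t] B])
    show "invertible (A0 + map_matrix ((*) (of_real t)) B)"
      using t by (simp add: invertible_det_nz)
    show "M = A0 + map_matrix ((*) (of_real t)) B + map_matrix ((*) (\<i> - of_real t)) B"
      unfolding M by (simp add: vec_eq_iff algebra_simps)
  qed
qed

text \<open>For real \<open>z\<close> the number \<open>det (z - K) det A\<close> is the determinant of the Hermitian matrix \<open>z A - K\<^sup>T A\<close>, so the
  characteristic polynomial of \<open>K\<close> takes real values at real points.\<close>
lemma real_cubic_of_hermitian_pencil:
  fixes A K :: "complex^3^3"
  assumes A: "hermitian_matrix A" "invertible A" and KA: "hermitian_matrix (transpose K ** A)"
  obtains t m k :: real where
    "\<And>x. K *v (K *v (K *v x)) = t *\<^sub>R (K *v (K *v x)) - m *\<^sub>R (K *v x) + k *\<^sub>R x"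
    "\<And>z. det (mat z - K) = z ^ 3 - of_real t * z\<^sup>2 + of_real m * z - of_real k"
proof -
  obtain t m where ch: "\<And>x. K *v (K *v (K *v x)) = t *s (K *v (K *v x)) - m *s (K *v x) + det K *s x"
    and char: "\<And>z. det (mat z - K) = z ^ 3 - t * z\<^sup>2 + m * z - det K"
    using cayley_hamilton_3[of K] by blast
  have real: "Im (det (mat (of_real z) - K)) = 0" for z
  proof -
    have "(mat (of_real z) - transpose K) ** A = map_matrix ((*) (of_real z)) A - transpose K ** A"
      by (simp add: vec_eq_iff forall_3 matrix_matrix_mult_def sum_3 mat_def algebra_simps)
    moreover have "hermitian_matrix (map_matrix ((*) (of_real z)) A - transpose K ** A)"
      by (rule hermitian_matrixI) (simp flip: hermitian_entry[OF A(1)] hermitian_entry[OF KA])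
    ultimately have "Im (det ((mat (of_real z) - transpose K) ** A)) = 0"
      using hermitian_det_real by simp
    then have *: "Im (det (mat (of_real z) - transpose K) * det A) = 0"
      by (simp only: det_mul)
    have "transpose (mat (of_real z) - K) = mat (of_real z) - transpose K"
      by (simp add: vec_eq_iff transpose_def mat_def)
    then have "det (mat (of_real z) - transpose K) = det (mat (of_real z) - K)"
      using det_transpose[of "mat (of_real z) - K"] by simp
    moreover have "Im (det A) = 0" "det A \<noteq> 0"
      using A hermitian_det_real by (auto simp: invertible_det_nz)
    ultimately show ?thesis using * by (simp add: complex_eq_iff)
  qed
  have "Im (det K) = 0" "Im t = 0" "Im m = 0"
    using real[of 0] real[of 1] real[of "- 1"] unfolding char by simp_all
  then obtain t' m' k where real_coeffs: "t = of_real t'" "m = of_real m'" "det K = of_real k"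
    by (meson Reals_cases complex_is_Real_iff)
  have "of_real r *s v = r *\<^sub>R v" for r and v :: "complex^3"
    unfolding vec_eq_iff vector_smult_component vector_scaleR_component by (simp add: scaleR_conv_of_real)
  from that[OF ch[unfolded real_coeffs this] char[unfolded real_coeffs]] show ?thesis .
qed

text \<open>The symplectic form is the imaginary part of the sesquilinear form of an invertible Hermitian member \<open>A\<close>, and \<open>N\<close> is
  multiplication by \<open>K = (B A\<^sup>-\<^sup>1)\<^sup>T\<close>.\<close>
theorem matrix_form_in_list:
  fixes M :: "complex^3^3"
  assumes "invertible M" and nonhermitian: "\<And>c. c \<noteq> 0 \<Longrightarrow> \<not> hermitian_matrix (map_matrix ((*) c) M)"
  shows "in_list (matrix_form M)"
proof -
  obtain A B :: "complex^3^3" and s :: real where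
    A: "hermitian_matrix A" "invertible A" and B: "hermitian_matrix B"
    and M: "M = A + map_matrix ((*) (\<i> - of_real s)) B"
    using hermitian_pencil_3[OF assms(1)] by blast
  obtain A' where A': "A' ** A = mat 1"
    using A(2) invertible_left_inverse by blast
  define K where "K = transpose (B ** A')"
  have KA: "transpose K ** A = B"
    using A' by (simp add: K_def flip: matrix_mul_assoc)
  obtain t m k :: real where
    cubic: "\<And>x. K *v (K *v (K *v x)) = t *\<^sub>R (K *v (K *v x)) - m *\<^sub>R (K *v x) + k *\<^sub>R x"
    and char: "\<And>z. det (mat z - K) = z ^ 3 - of_real t * z\<^sup>2 + of_real m * z - of_real k"
    using real_cubic_of_hermitian_pencil[OF A] B KA by metis
  obtain r where r: "r ^ 3 - t * r\<^sup>2 + m * r - k = 0"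
    using real_cubic_root by blast
  have "det (mat (of_real r) - K) = of_real (r ^ 3 - t * r\<^sup>2 + m * r - k)"
    unfolding char by simp
  then have "\<not> invertible (mat (of_real r) - K)"
    unfolding r by (simp add: invertible_det_nz)
  then obtain u where u: "u \<noteq> 0" "(mat (of_real r) - K) *v u = 0"
    by (metis invertible_left_inverse matrix_left_invertible_ker)
  have Ku: "K *v u = r *\<^sub>R u"
  proof -
    have "mat (of_real r) *v u = r *\<^sub>R u"
      unfolding vec_eq_iff vector_scaleR_component
      by (simp add: forall_3 matrix_vector_mult_def mat_def sum_3 scaleR_conv_of_real)
    then show ?thesis
      using u(2) by (simp add: matrix_vector_mult_diff_rdistrib)
  qed
  define F where "F x y = Im (sesq A x y)" for x y
  have sesq_K: "sesq A (K *v x) y = sesq B x y" for x y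
  proof -
    have "transpose A *v (K *v x) = transpose (transpose K ** A) *v x"
      by (simp add: matrix_transpose_mul matrix_vector_mul_assoc del: vector_transpose_matrix transpose_matrix_vector)
    then show ?thesis unfolding sesq_def KA by simp
  qed
  have Im_sesq: "Im (sesq H x x) = 0" if "hermitian_matrix H" for H :: "complex^3^3" and x
    using sesq_hermitian[OF that, of x x] by (simp add: complex_eq_iff)
  have F: "bilinear F"
    unfolding bilinear_def F_def
    by (auto intro!: linearI simp: bilinear_ladd[OF bilinear_sesq] bilinear_radd[OF bilinear_sesq]
        bilinear_lmul[OF bilinear_sesq] bilinear_rmul[OF bilinear_sesq])
  interpret symplectic_pencil F "(*v) K"
  proof (rule symplectic_pencil.intro)
    show "bilinear F" by (rule F)
    show "F x x = 0" for x
      unfolding F_def using Im_sesq[OF A(1)] .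
    show "F (K *v x) x = 0" for x
      unfolding F_def sesq_K using Im_sesq[OF B] .
    show "x = 0" if "\<And>y. F x y = 0" for x
      using sesq_nondegenerate[OF A(2)] that unfolding F_def by blast
    show "linear ((*v) K)"
      by (rule matrix_vector_mul_linear)
    show "\<exists>w. w \<noteq> 0 \<and> F w a = 0 \<and> F w b = 0 \<and> F w c = 0 \<and> F w d = 0" for a b c d
    proof -
      define f where "f w = (F w a, F w b, F w c, F w d)" for w :: "complex^3"
      have "linear f"
        using bilinear_ladd[OF F] bilinear_lmul[OF F]
        by (intro linearI) (simp_all add: f_def)
      moreover have "\<not> inj f"
      proof
        assume "inj f"
        then have "dim (range f) = DIM(complex^3)"
          using dim_image_eq[OF \<open>linear f\<close>, of UNIV] by simp
        then show False using dim_subset_UNIV[of "range f"] by simp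
      qed
      ultimately obtain w where "w \<noteq> 0" "f w = 0"
        using linear_injective_0 by blast
      then show ?thesis by (auto simp: f_def zero_prod_def)
    qed
  qed
  have nonscalar: "\<exists>x. K *v x \<noteq> a *\<^sub>R x" for a
  proof (rule ccontr)
    assume "\<not> ?thesis"
    then have "sesq B x y = of_real a * sesq A x y" for x y
      unfolding sesq_K[symmetric] using bilinear_lmul[OF bilinear_sesq[of A]] by (simp add: scaleR_conv_of_real)
    then have B_entry: "B $ i $ j = of_real a * A $ i $ j" for i j
      by (metis sesq_axis)
    define c where "c = 1 + (\<i> - of_real s) * of_real a"
    have M_c: "M = map_matrix ((*) c) A"
      by (simp add: M vec_eq_iff B_entry c_def algebra_simps)
    have "c \<noteq> 0"
    proof
      assume "c = 0"
      then have "M = 0" by (simp add: M_c vec_eq_iff)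
      then show False using assms(1) by (simp add: invertible_det_nz det_3)
    qed
    moreover have "map_matrix ((*) (1 / c)) M = A"
      using \<open>c \<noteq> 0\<close> by (simp add: M_c vec_eq_iff)
    ultimately show False using nonhermitian[of "1 / c"] A(1) by simp
  qed
  have "matrix_form M = D (2 * \<i>) ((\<i> - of_real s) * (2 * \<i>))"
  proof (intro ext)
    fix x y
    have "matrix_form M x y = matrix_form A x y + (\<i> - of_real s) * matrix_form B x y"
      unfolding M matrix_form_sesq sesq_add sesq_scale by (simp add: algebra_simps)
    then show "matrix_form M x y = D (2 * \<i>) ((\<i> - of_real s) * (2 * \<i>)) x y"
      unfolding D_def F_def sesq_K matrix_form_hermitian[OF A(1)] matrix_form_hermitian[OF B]
      by (simp add: algebra_simps)
  qed
  moreover have "in_list (D (2 * \<i>) ((\<i> - of_real s) * (2 * \<i>)))"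
    by (rule symplectic_pencil_in_list[OF _ nonscalar cubic u(1) Ku]) simp
  ultimately show ?thesis by simp
qed


section \<open>From two-forms to Lie algebras\<close>

lemma forall_8: "(\<forall>i::8. P i) \<longleftrightarrow> P 1 \<and> P 2 \<and> P 3 \<and> P 4 \<and> P 5 \<and> P 6 \<and> P 7 \<and> P 8"
proof (intro iffI allI)
  fix i :: 8
  assume "P 1 \<and> P 2 \<and> P 3 \<and> P 4 \<and> P 5 \<and> P 6 \<and> P 7 \<and> P 8"
  then show "P i" using eight_exhaust[of i] by auto
qed simp

text \<open>The domain is a bare real vector space, so its basis has to be transported by hand.\<close>
lemma linear_injective_imp_bij:
  fixes f :: "'a::real_vector \<Rightarrow> 'b::euclidean_space"
  assumes "linear f" "inj f" and dim: "dim (UNIV :: 'a set) = DIM('b)"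
  shows "bij f"
proof -
  obtain B :: "'a set" where B: "independent B" "span B = UNIV" "card B = DIM('b)"
    using basis_exists[of "UNIV :: 'a set"] dim by (metis top.extremum_uniqueI)
  have "independent (f ` B)"
    using assms(1,2) B(1) by (metis inj_on_subset linear_independent_injective_image top_greatest)
  moreover have "card (f ` B) = DIM('b)"
    using B(3) assms(2) by (metis card_image inj_on_subset top_greatest)
  ultimately have "span (f ` B) = UNIV"
    using card_ge_dim_independent[of "f ` B" UNIV] by auto
  then have "range f = UNIV"
    using linear_span_image[OF assms(1), of B] B(2) by simp
  then show ?thesis using assms(2) by (simp add: bij_def)
qed

lemma separating_functional:
  fixes x :: "'a::real_vector"
  assumes "x \<noteq> 0"
  obtains \<phi> :: "'a \<Rightarrow> real" where "linear \<phi>" "\<phi> x = 1"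
proof -
  have "independent {x}" using assms by simp
  then show ?thesis
    using linear_independent_extend[of "{x}" "\<lambda>_. 1 :: real"] that by auto
qed

text \<open>Every real functional \<open>\<phi>\<close> is the real part of the \<open>(1,0)\<close>-form \<open>\<phi> - \<i> (\<phi> \<circ> J)\<close>.\<close>
lemma forms_1_0_separate:
  assumes J: "linear J" "\<And>x. J (J x) = - x" and "\<And>\<omega>. \<omega> \<in> forms_1_0 J \<Longrightarrow> \<omega> x = 0"
  shows "x = 0"
proof (rule ccontr)
  assume "x \<noteq> 0"
  then obtain \<phi> :: "_ \<Rightarrow> real" where \<phi>: "linear \<phi>" "\<phi> x = 1"
    by (rule separating_functional)
  define \<omega> where "\<omega> v = Complex (\<phi> v) (- \<phi> (J v))" for v
  have "\<omega> \<in> forms_1_0 J"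
    unfolding forms_1_0_def
    using \<phi>(1) J by (auto intro!: linearI simp: \<omega>_def linear_add linear_cmul linear_neg complex_eq_iff)
  then have "\<omega> x = 0" by (rule assms(3))
  then show False using \<phi>(2) by (simp add: \<omega>_def complex_eq_iff)
qed

lemma cform_span_vanishes:
  assumes "\<omega> \<in> cform_span S" "\<And>\<eta>. \<eta> \<in> S \<Longrightarrow> \<eta> x = 0"
  shows "\<omega> x = 0"
  using assms(1) by (rule cform.span_induct_alt) (use assms(2) in auto)

text \<open>The forms \<open>\<omega>\<^sup>1, \<dots>, \<omega>\<^sup>4\<close> identify the Lie algebra with \<open>\<complex>\<^sup>3 \<times> \<complex>\<close>, where the bracket is \<open>- matrix_form M\<close> in the second
  factor. The map \<open>T\<close> on the first six coordinates and \<open>k\<close>, \<open>l\<close> on the last two identify the target with the same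
  space. The latter map is injective since a vector in its kernel lies in the common radical of \<open>\<Omega>\<close> and \<open>\<Psi>\<close>.\<close>
lemma realizes_imp_lie_isomorphic:
  fixes br :: "'a::real_vector \<Rightarrow> 'a \<Rightarrow> 'a" and M :: "complex^3^3"
  assumes dim: "dim (UNIV :: 'a set) = 8" and J: "linear J" "\<And>x. J (J x) = - x"
    and M: "is_J_M br J M"
    and realizes: "realizes (matrix_form M) \<Omega> \<Psi>"
    and radical: "\<And>x. \<forall>j. \<Omega> x (axis j 1) = 0 \<and> \<Psi> x (axis j 1) = 0 \<Longrightarrow>
      x $ 1 = 0 \<and> x $ 2 = 0 \<and> x $ 3 = 0 \<and> x $ 4 = 0 \<and> x $ 5 = 0 \<and> x $ 6 = 0"
  shows "lie_isomorphic br (bracket_of \<Omega> \<Psi>)"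
proof -
  obtain \<eta> :: "3 \<Rightarrow> 'a \<Rightarrow> complex" and \<zeta> where basis: "basis_1_0 J \<eta> \<zeta>"
    and d\<eta>: "\<And>j x y. ce_d br (\<eta> j) x y = 0"
    and d\<zeta>: "\<And>x y. ce_d br \<zeta> x y =
      (\<Sum>j\<in>UNIV. \<Sum>k\<in>UNIV. M $ j $ k * wedge (\<eta> j) (\<lambda>v. cnj (\<eta> k v)) x y)"
    using M unfolding is_J_M_def by blast
  have span: "cform_span (insert \<zeta> (range \<eta>)) = forms_1_0 J"
    using basis unfolding basis_1_0_def by blast
  have "insert \<zeta> (range \<eta>) \<subseteq> forms_1_0 J"
    unfolding span[symmetric] by (rule cform.span_superset)
  then have lin: "linear \<zeta>" "linear (\<eta> j)" for j
    unfolding forms_1_0_def by auto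
  define H where "H x = (\<chi> j. \<eta> j x)" for x
  define \<Phi> where "\<Phi> x = (H x, \<zeta> x)" for x
  have "linear \<Phi>"
    by (intro linearI) (simp_all add: \<Phi>_def H_def vec_eq_iff linear_add[OF lin(1)] linear_add[OF lin(2)]
        linear_cmul[OF lin(1)] linear_cmul[OF lin(2)])
  moreover have "inj \<Phi>"
  proof (subst linear_injective_0[OF \<open>linear \<Phi>\<close>], intro allI impI)
    fix x assume "\<Phi> x = 0"
    then have "\<eta> j x = 0" "\<zeta> x = 0" for j
      by (auto simp: \<Phi>_def H_def vec_eq_iff zero_prod_def)
    then have "\<omega> x = 0" if "\<omega> \<in> forms_1_0 J" for \<omega>
      using that unfolding span[symmetric] by (rule_tac cform_span_vanishes) auto
    then show "x = 0" using forms_1_0_separate[OF J] by blast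
  qed
  ultimately have "bij \<Phi>"
    by (rule linear_injective_imp_bij) (simp add: dim)
  have H_br: "H (br x y) = 0" for x y
    using d\<eta>[of _ x y] by (simp add: H_def ce_d_def vec_eq_iff)
  have \<zeta>_br: "\<zeta> (br x y) = - matrix_form M (H x) (H y)" for x y
    using d\<zeta>[of x y] by (simp add: ce_d_def wedge_def matrix_form_def H_def eq_neg_iff_add_eq_0 neg_eq_iff_add_eq_0)
  obtain T k l where T: "linear T" "\<And>x. (\<And>i. i \<notin> {7, 8} \<Longrightarrow> x $ i = 0) \<Longrightarrow> T x = 0"
    and kl: "Im (k * cnj l) \<noteq> 0"
    and form: "\<And>x y. matrix_form M (T x) (T y) = of_real (\<Omega> x y) * k + of_real (\<Psi> x y) * l"
    using realizes unfolding realizes_def by blast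
  have independent: "a = 0" "b = 0" if "of_real a * k + of_real b * l = 0" for a b :: real
  proof -
    have "Im ((of_real a * k + of_real b * l) * cnj l) = a * Im (k * cnj l)"
      "Im ((of_real a * k + of_real b * l) * cnj k) = - b * Im (k * cnj l)"
      by (simp_all add: algebra_simps)
    then show "a = 0" "b = 0" using that kl by simp_all
  qed
  define L where "L x = (T x, of_real (x $ 7) * k + of_real (x $ 8) * l)" for x
  have "linear L"
    by (intro linearI) (simp_all add: L_def linear_add[OF T(1)] linear_cmul[OF T(1)]
        scaleR_conv_of_real[where 'a = complex] algebra_simps)
  moreover have "inj L"
  proof (subst linear_injective_0[OF \<open>linear L\<close>], intro allI impI)
    fix x assume "L x = 0"
    then have x: "T x = 0" "of_real (x $ 7) * k + of_real (x $ 8) * l = 0"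
      by (simp_all add: L_def zero_prod_def)
    have "\<Omega> x y = 0 \<and> \<Psi> x y = 0" for y
      using independent[of "\<Omega> x y" "\<Psi> x y"] form[of x y] by (simp add: x(1) matrix_form_def)
    then show "x = 0"
      using radical[of x] independent[OF x(2)] by (simp add: vec_eq_iff forall_8)
  qed
  ultimately have "bij L"
    by (rule linear_injective_imp_bij) simp
  define f where "f = inv L \<circ> \<Phi>"
  have "bij f"
    unfolding f_def using \<open>bij L\<close> \<open>bij \<Phi>\<close> by (simp add: bij_comp bij_imp_bij_inv)
  have Lf: "L (f x) = \<Phi> x" for x
    using \<open>bij L\<close> by (simp add: f_def bij_is_surj surj_f_inv_f)
  have f_eq: "f x = y" if "\<Phi> x = L y" for x y
    using that \<open>bij L\<close> by (simp add: f_def bij_is_inj)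
  have "linear f"
    by (intro linearI f_eq)
      (simp_all add: linear_add[OF \<open>linear \<Phi>\<close>] linear_add[OF \<open>linear L\<close>] linear_cmul[OF \<open>linear \<Phi>\<close>]
        linear_cmul[OF \<open>linear L\<close>] Lf)
  moreover have "f (br x y) = bracket_of \<Omega> \<Psi> (f x) (f y)" for x y
  proof (rule f_eq)
    have "T (f z) = H z" for z
      using Lf[of z] by (simp add: L_def \<Phi>_def)
    moreover have "T (bracket_of \<Omega> \<Psi> (f x) (f y)) = 0"
      by (rule T(2)) (simp add: bracket_of_def)
    ultimately show "\<Phi> (br x y) = L (bracket_of \<Omega> \<Psi> (f x) (f y))"
      using form[of "f x" "f y"] by (simp add: \<Phi>_def L_def H_br \<zeta>_br bracket_of_def)
  qed
  ultimately show ?thesis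
    unfolding lie_isomorphic_def using \<open>bij f\<close> by blast
qed

lemma in_list_imp_lie_isomorphic:
  fixes br :: "'a::real_vector \<Rightarrow> 'a \<Rightarrow> 'a" and M :: "complex^3^3"
  assumes dim: "dim (UNIV :: 'a set) = 8" and J: "linear J" "\<And>x. J (J x) = - x"
    and M: "is_J_M br J M" and "in_list (matrix_form M)"
  shows "lie_isomorphic br g8_r1 \<or> lie_isomorphic br g8_r2 \<or> lie_isomorphic br g8_r3 \<or>
         lie_isomorphic br g8_r4 \<or> lie_isomorphic br g8_r5 \<or> lie_isomorphic br g8_r6"
proof -
  note iso = realizes_imp_lie_isomorphic[OF dim J M]
  note radical = forall_8 ee_def wedge_def e_def axis_def
  show ?thesis
    using assms(5) unfolding in_list_def
      g8_r1_def g8_r2_def g8_r3_def g8_r4_def g8_r5_def g8_r6_def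
    by (elim disj_forward) (rule iso, assumption, simp add: radical)+
qed

theorem theorem4p22:
  fixes br :: "'a::real_vector \<Rightarrow> 'a \<Rightarrow> 'a"
    and J :: "'a \<Rightarrow> 'a"
    and M :: "complex^3^3"
  assumes "one_abelian 4 br J"
    and "is_J_M br J M"
    and "invertible M"
    and "\<not> (\<exists>H :: complex^3^3. hermitian_matrix H \<and> is_J_M br J H)"
  shows "lie_isomorphic br g8_r1 \<or> lie_isomorphic br g8_r2 \<or> lie_isomorphic br g8_r3 \<or>
         lie_isomorphic br g8_r4 \<or> lie_isomorphic br g8_r5 \<or> lie_isomorphic br g8_r6"
proof -
  have dim: "dim (UNIV :: 'a set) = 8" and J: "linear J" "\<And>x. J (J x) = - x"
    using assms(1)
    unfolding one_abelian_def abelian_complex_structure_def complex_structure_def by auto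
  have "in_list (matrix_form M)"
  proof (rule matrix_form_in_list[OF assms(3)])
    fix c :: complex
    assume "c \<noteq> 0"
    from is_J_M_scale[OF assms(2) this] assms(4) show "\<not> hermitian_matrix (map_matrix ((*) c) M)"
      by blast
  qed
  then show ?thesis
    by (rule in_list_imp_lie_isomorphic[OF dim J assms(2)])
qed

end
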